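(* Let $(R,\mathfrak{m})$ be a Noetherian local ring and let $\varphi$ be a self-map of finite length of $R$. Assume that every minimal prime ideal $\mathfrak{p}_i$ of $R$ satisfies $\varphi(\mathfrak{p}_i)R\subseteq\mathfrak{p}_i$, and let $\overline\varphi_i$ be the self-map induced by $\varphi$ on $R/\mathfrak{p}_i$. Then $$h_{\mathrm{alg}}(\varphi,R)=\max\{h_{\mathrm{alg}}(\overline\varphi_i,R/\mathfrak{p}_i)\mid \mathfrak{p}_i\in\operatorname{Min}(R)\}.$$
   Context: $\operatorname{Min}(R)$ denotes the set of minimal prime ideals of $R$. A self-map of finite length of a Noetherian local ring $(A,\mathfrak{n})$ is a ring endomorphism $\psi$ with $\psi(\mathfrak{n})\subseteq\mathfrak{n}$ and $\psi(\mathfrak{n})A$ $\mathfrak{n}$-primary; if $\mathfrak{a}$ is an ideal with $\varphi(\mathfrak{a})R\subseteq\mathfrak{a}$, then $\varphi$ induces such a self-map on $R/\mathfrak{a}$. Put $\lambda(\psi^n):=\ell_A(A/\psi^n(\mathfrak{n})A)$; the algebraic entropy is $h_{\mathrm{alg}}(\psi,A):=\lim_{n\to\infty}\frac1n\log\lambda(\psi^n)$ (the limit exists). *)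

theory Defs
  imports "HOL-Algebra.Algebra" "HOL-Analysis.Analysis"
begin

definition local_ring :: "('a, 'b) ring_scheme \<Rightarrow> bool" where
  "local_ring A \<longleftrightarrow> cring A \<and> (\<exists>!n. maximalideal n A)"

definition noetherian_local_ring :: "('a, 'b) ring_scheme \<Rightarrow> bool" where
  "noetherian_local_ring A \<longleftrightarrow> noetherian_ring A \<and> local_ring A"

definition max_ideal :: "('a, 'b) ring_scheme \<Rightarrow> 'a set" where
  "max_ideal A = (THE n. maximalideal n A)"

definition radical :: "('a, 'b) ring_scheme \<Rightarrow> 'a set \<Rightarrow> 'a set" where
  "radical A I = {x \<in> carrier A. \<exists>k::nat. x [^]\<^bsub>A\<^esub> k \<in> I}"

definition primary_ideal :: "('a, 'b) ring_scheme \<Rightarrow> 'a set \<Rightarrow> bool" where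
  "primary_ideal A Q \<longleftrightarrow> ideal Q A \<and> Q \<noteq> carrier A \<and>
     (\<forall>x\<in>carrier A. \<forall>y\<in>carrier A. x \<otimes>\<^bsub>A\<^esub> y \<in> Q \<longrightarrow> x \<in> Q \<or> y \<in> radical A Q)"

definition is_primary_for :: "('a, 'b) ring_scheme \<Rightarrow> 'a set \<Rightarrow> 'a set \<Rightarrow> bool" where
  "is_primary_for A n Q \<longleftrightarrow> primary_ideal A Q \<and> radical A Q = n"

definition self_map_finite_length :: "('a, 'b) ring_scheme \<Rightarrow> ('a \<Rightarrow> 'a) \<Rightarrow> bool" where
  "self_map_finite_length A \<psi> \<longleftrightarrow>
     \<psi> \<in> ring_hom A A \<and> \<psi> ` max_ideal A \<subseteq> max_ideal A \<and>
     is_primary_for A (max_ideal A) (Idl\<^bsub>A\<^esub> (\<psi> ` max_ideal A))"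

text \<open>Length of the A-module A/I. By the correspondence between submodules of A/I
  and ideals of A containing I, this is the supremum of the lengths k of strictly
  increasing chains of ideals I = J_0 \<subset> J_1 \<subset> ... \<subset> J_k = A.\<close>
definition length_quot :: "('a, 'b) ring_scheme \<Rightarrow> 'a set \<Rightarrow> enat" where
  "length_quot A I = Sup {enat k | k. \<exists>J :: nat \<Rightarrow> 'a set.
      (\<forall>i\<le>k. ideal (J i) A) \<and> J 0 = I \<and> J k = carrier A \<and> (\<forall>i<k. J i \<subset> J (Suc i))}"

definition lambda_len :: "('a, 'b) ring_scheme \<Rightarrow> ('a \<Rightarrow> 'a) \<Rightarrow> nat \<Rightarrow> enat" where
  "lambda_len A \<psi> k = length_quot A (Idl\<^bsub>A\<^esub> ((\<psi> ^^ k) ` max_ideal A))"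

definition h_alg :: "('a \<Rightarrow> 'a) \<Rightarrow> ('a, 'b) ring_scheme \<Rightarrow> real" where
  "h_alg \<psi> A = lim (\<lambda>k. ln (real (the_enat (lambda_len A \<psi> k))) / real k)"

definition minimal_primes :: "('a, 'b) ring_scheme \<Rightarrow> 'a set set" where
  "minimal_primes A = {p. primeideal p A \<and> (\<forall>q. primeideal q A \<and> q \<subseteq> p \<longrightarrow> q = p)}"

text \<open>Map induced on A/a by phi (when phi(a)A \<subseteq> a): the class of x goes to the class of phi x.\<close>
definition induced_map :: "('a, 'b) ring_scheme \<Rightarrow> 'a set \<Rightarrow> ('a \<Rightarrow> 'a) \<Rightarrow> 'a set \<Rightarrow> 'a set" where
  "induced_map A P g C = P +>\<^bsub>A\<^esub> (g (SOME x. x \<in> C))"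

end

theory Submission
  imports Defs
begin

text \<open>Write \<open>\<ell>(I)\<close> for the length of \<open>R / I\<close> and \<open>I\<^sub>n\<close> for \<open>\<phi>\<^sup>n(\<mm>)R\<close>. For a proper \<open>\<phi>\<close>-stable ideal
  \<open>a\<close>, the length of the quotient of \<open>R / a\<close> by the expansion of its maximal ideal is \<open>\<ell>(I\<^sub>n + a)\<close>. Applying
  \<open>\<phi>\<^sup>n\<close> to a composition series of \<open>R / (I\<^sub>m + a)\<close> shows that this is submultiplicative in \<open>n\<close>, so by
  Fekete's lemma all the limits exist. Clearly \<open>\<ell>(I\<^sub>n + p) \<le> \<ell>(I\<^sub>n)\<close>. Conversely some product of
  minimal primes \<open>q\<^sub>1 \<dots> q\<^sub>t\<close> vanishes; filtering \<open>R\<close> by the partial products, each factor is a finitely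
  generated module over some \<open>R / q\<^sub>i\<close>, whence \<open>\<ell>(I\<^sub>n) \<le> C max\<^sub>i \<ell>(I\<^sub>n + q\<^sub>i)\<close> with \<open>C\<close> independent
  of \<open>n\<close>. The constant disappears in \<open>(1/n) log\<close>.\<close>

section \<open>Subadditive sequences\<close>

text \<open>Fekete's argument: the limit is the infimum of \<open>a n / real n\<close>. Choose
  \<open>N\<close> where the quotient is nearly minimal and divide \<open>n\<close> by
  \<open>N\<close> with remainder; the full blocks contribute at most \<open>a N / real N\<close> on
  average, the remainder only a bounded amount divided by \<open>n\<close>.\<close>

lemma fekete_subadditive_convergent:
  fixes a :: "nat \<Rightarrow> real"
  assumes sub: "\<And>m n. a (m + n) \<le> a m + a n" and nonneg: "\<And>n. 0 \<le> a n"
  shows "convergent (\<lambda>n. a n / real n)"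
proof -
  \<comment> \<open>Indices start at 1 because \<open>a 0 / real 0\<close> is 0 by convention and
    would force the infimum to be 0.\<close>
  define S where "S = (\<lambda>n. a n / real n) ` {1..}"
  define l where "l = Inf S"
  have ne: "S \<noteq> {}" and bdd: "bdd_below S"
    unfolding S_def by (auto intro!: bdd_belowI2[where m = 0] simp: nonneg)
  have mult: "a (q * N + r) \<le> real q * a N + a r" for q N r
  proof (induction q)
    case (Suc q)
    have "a (Suc q * N + r) \<le> a N + a (q * N + r)"
      using sub[of N "q * N + r"] by (simp add: add.assoc)
    with Suc show ?case by (simp add: algebra_simps)
  qed simp
  have "(\<lambda>n. a n / real n) \<longlonglongrightarrow> l"
  proof (rule LIMSEQ_I)
    fix e :: real assume e: "e > 0"
    obtain N where N: "N \<ge> 1" "a N / real N < l + e / 2"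
      using cInf_lessD[OF ne, of "l + e / 2"] e unfolding S_def l_def by auto
    define M where "M = Max (a ` {..<N})"
    have M: "a r \<le> M" if "r < N" for r
      unfolding M_def using that by auto
    have upper: "a n / real n \<le> a N / real N + M / real n" if "n \<ge> 1" for n
    proof -
      have "a n \<le> real (n div N) * a N + a (n mod N)"
        using mult[of "n div N" N "n mod N"] by simp
      also have "\<dots> \<le> real (n div N) * a N + M"
        using M[of "n mod N"] N by simp
      \<comment> \<open>Full blocks cover at most \<open>n\<close> indices, so by nonnegativity of
        \<open>a N\<close> the factor \<open>n div N * N\<close> may be rounded up to
        \<open>n\<close>.\<close>
      also have "real (n div N) * a N = real (n div N * N) * (a N / real N)"
        using N by simp
      also have "\<dots> \<le> real n * (a N / real N)"
        by (intro mult_right_mono) (auto simp: nonneg simp del: of_nat_mult)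
      finally have "a n \<le> real n * (a N / real N) + M" by simp
      then show ?thesis using that by (simp add: field_simps)
    qed
    have "(\<lambda>n. M / real n) \<longlonglongrightarrow> 0" by (rule lim_const_over_n)
    then have "eventually (\<lambda>n. M / real n < e / 2) sequentially"
      by (rule order_tendstoD(2)) (use e in simp)
    then obtain n0 where n0: "\<And>n. n \<ge> n0 \<Longrightarrow> M / real n < e / 2"
      unfolding eventually_sequentially by blast
    have "norm (a n / real n - l) < e" if "n \<ge> max n0 1" for n
    proof -
      have "l \<le> a n / real n"
        unfolding l_def by (rule cInf_lower[OF _ bdd]) (use that in \<open>auto simp: S_def\<close>)
      moreover have "a n / real n < l + e"
        using upper[of n] n0[of n] N(2) that by linarith
      ultimately show ?thesis by simp
    qed
    then show "\<exists>no. \<forall>n\<ge>no. norm (a n / real n - l) < e" by blast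
  qed
  then show ?thesis by (rule convergentI)
qed

text \<open>A squeeze in which the index realising the upper bound may change with \<open>n\<close>.
  The constant \<open>d\<close> will be the logarithm of a multiplicative constant and vanishes
  after division by \<open>n\<close>.\<close>

lemma lim_eq_Max_lim:
  fixes a :: "nat \<Rightarrow> real" and b :: "'i \<Rightarrow> nat \<Rightarrow> real"
  assumes "finite I" "I \<noteq> {}" and lim: "a \<longlonglongrightarrow> l" "\<And>i. i \<in> I \<Longrightarrow> b i \<longlonglongrightarrow> h i"
    and lower: "\<And>i n. i \<in> I \<Longrightarrow> n \<ge> 1 \<Longrightarrow> b i n \<le> a n"
    and upper: "\<And>n. n \<ge> 1 \<Longrightarrow> \<exists>i\<in>I. a n \<le> d / real n + b i n"
  shows "l = Max (h ` I)"
proof (rule antisym)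
  show "Max (h ` I) \<le> l"
  proof (rule Max.boundedI)
    fix y assume "y \<in> h ` I"
    then obtain i where i: "i \<in> I" "y = h i" by blast
    show "y \<le> l"
      unfolding i using lower[OF i(1)] by (intro LIMSEQ_le[OF lim(2)[OF i(1)] lim(1)]) blast
  qed (use assms in auto)
  show "l \<le> Max (h ` I)"
  proof (rule field_le_epsilon)
    fix e :: real assume "e > 0"
    \<comment> \<open>Finiteness of \<open>I\<close> gives one threshold valid for all indices, so
      it does not matter which one \<open>upper\<close> selects.\<close>
    have "eventually (\<lambda>n. \<forall>i\<in>I. b i n < Max (h ` I) + e) sequentially"
    proof (intro eventually_ball_finite[OF assms(1)] ballI)
      fix i assume i: "i \<in> I"
      have "h i < Max (h ` I) + e"
        using Max_ge[of "h ` I" "h i"] i assms(1) \<open>e > 0\<close> by (simp add: le_less_trans[of _ "Max (h ` I)"])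
      then show "eventually (\<lambda>n. b i n < Max (h ` I) + e) sequentially"
        using order_tendstoD(2)[OF lim(2)[OF i]] by blast
    qed
    then have "eventually (\<lambda>n. a n \<le> d / real n + (Max (h ` I) + e)) sequentially"
      using eventually_ge_at_top[of 1]
    proof eventually_elim
      case (elim n)
      then obtain i where "i \<in> I" "a n \<le> d / real n + b i n" using upper by blast
      moreover have "b i n < Max (h ` I) + e" using elim(1) \<open>i \<in> I\<close> by blast
      ultimately show ?case by linarith
    qed
    moreover have "(\<lambda>n. d / real n + (Max (h ` I) + e)) \<longlonglongrightarrow> 0 + (Max (h ` I) + e)"
      by (intro tendsto_add lim_const_over_n tendsto_const)
    ultimately show "l \<le> Max (h ` I) + e"
      using tendsto_le[OF _ _ lim(1)] by force
  qed
qed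

section \<open>Chains of ideals\<close>

text \<open>\<open>r\<close> witnesses that chains of ideals between \<open>A\<close> and \<open>B\<close> have length at most \<open>b\<close>.\<close>
definition ideal_rank :: "('a, 'b) ring_scheme \<Rightarrow> 'a set \<Rightarrow> 'a set \<Rightarrow> nat \<Rightarrow> ('a set \<Rightarrow> nat) \<Rightarrow> bool" where
  "ideal_rank R A B b r \<longleftrightarrow>
     (\<forall>U V. ideal U R \<and> ideal V R \<and> A \<subseteq> U \<and> U \<subset> V \<and> V \<subseteq> B \<longrightarrow> r U < r V) \<and>
     (\<forall>U. ideal U R \<and> A \<subseteq> U \<and> U \<subseteq> B \<longrightarrow> r U \<le> b)"

text \<open>Estimating through rank functions avoids refining chains: ranks on two pieces add, and
  ranks pull back along maps of ideals. The link with the supremum over chains is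
  \<open>length_quot_le_iff\<close>.\<close>

definition length_at_most :: "('a, 'b) ring_scheme \<Rightarrow> 'a set \<Rightarrow> 'a set \<Rightarrow> nat \<Rightarrow> bool" where
  "length_at_most R A B b \<longleftrightarrow> (\<exists>r. ideal_rank R A B b r)"

lemma ideal_rank_less:
  "ideal_rank R A B b r \<Longrightarrow> ideal U R \<Longrightarrow> ideal V R \<Longrightarrow> A \<subseteq> U \<Longrightarrow> U \<subset> V \<Longrightarrow> V \<subseteq> B \<Longrightarrow> r U < r V"
  unfolding ideal_rank_def by simp

lemma ideal_rank_le:
  "ideal_rank R A B b r \<Longrightarrow> ideal U R \<Longrightarrow> A \<subseteq> U \<Longrightarrow> U \<subseteq> B \<Longrightarrow> r U \<le> b"
  unfolding ideal_rank_def by simp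

lemma length_at_mostI:
  assumes "\<And>U V. ideal U R \<Longrightarrow> ideal V R \<Longrightarrow> A \<subseteq> U \<Longrightarrow> U \<subset> V \<Longrightarrow> V \<subseteq> B \<Longrightarrow> r U < r V"
    and "\<And>U. ideal U R \<Longrightarrow> A \<subseteq> U \<Longrightarrow> U \<subseteq> B \<Longrightarrow> r U \<le> b"
  shows "length_at_most R A B b"
  unfolding length_at_most_def ideal_rank_def using assms by (intro exI[of _ r]) simp

lemma length_at_most_mono:
  assumes "length_at_most R A B b" "A \<subseteq> A'" "B' \<subseteq> B" "b \<le> b'"
  shows "length_at_most R A' B' b'"
proof -
  obtain r where "ideal_rank R A B b r"
    using assms(1) unfolding length_at_most_def by blast
  note r = ideal_rank_less[OF this] ideal_rank_le[OF this]
  show ?thesis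
  proof (rule length_at_mostI[of R _ _ r])
    fix U V assume "ideal U R" "ideal V R" "A' \<subseteq> U" "U \<subset> V" "V \<subseteq> B'"
    then show "r U < r V" using r(1)[of U V] assms(2,3) by auto
  next
    fix U assume "ideal U R" "A' \<subseteq> U" "U \<subseteq> B'"
    then show "r U \<le> b'" using r(2)[of U] assms(2-4) by (meson order_trans)
  qed
qed

lemma length_at_most_refl: "length_at_most R A A 0"
  by (rule length_at_mostI[of R _ _ "\<lambda>_. 0"]) auto

context cring
begin

lemma ideal_subset_carrier: "ideal I R \<Longrightarrow> I \<subseteq> carrier R"
  by (meson additive_subgroup.a_subset ideal.axioms(1))

lemma ideal_add: "ideal I R \<Longrightarrow> x \<in> I \<Longrightarrow> y \<in> I \<Longrightarrow> x \<oplus> y \<in> I"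
  by (simp add: additive_subgroup.a_closed ideal.axioms(1))

lemma ideal_minus: "ideal I R \<Longrightarrow> x \<in> I \<Longrightarrow> \<ominus> x \<in> I"
  by (simp add: additive_subgroup.a_inv_closed ideal.axioms(1))

lemma ideal_add_cancel_left:
  assumes "ideal I R" "x \<in> I" "y \<in> carrier R" "x \<oplus> y \<in> I"
  shows "y \<in> I"
proof -
  have "x \<in> carrier R" using assms ideal.Icarr by metis
  then have "y = \<ominus> x \<oplus> (x \<oplus> y)" using assms(3) by (simp add: r_neg1)
  then show ?thesis using assms ideal_add ideal_minus by metis
qed

lemma genideal_insertE:
  assumes A: "ideal A R" and x: "x \<in> carrier R" and y: "y \<in> Idl (insert x A)"
  obtains a s where "a \<in> A" "s \<in> carrier R" "y = a \<oplus> s \<otimes> x"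
proof -
  have P: "ideal (PIdl x) R" by (rule cgenideal_ideal[OF x])
  have "insert x A \<subseteq> A \<union> PIdl x" using cgenideal_self[OF x] by blast
  then have "Idl (insert x A) \<subseteq> Idl (A \<union> PIdl x)"
    using ideal_subset_carrier[OF A] ideal_subset_carrier[OF P] by (intro subset_Idl_subset) auto
  then have "y \<in> A <+>\<^bsub>R\<^esub> PIdl x" using y union_genideal[OF A P] by auto
  then obtain a s where "a \<in> A" "s \<in> carrier R" "y = a \<oplus> s \<otimes> x"
    unfolding set_add_def' cgenideal_def by blast
  then show ?thesis by (rule that)
qed

text \<open>The colon ideal \<open>(U : x)\<close>. It transports ideals between \<open>A\<close>
  and \<open>A + Rx\<close> to ideals of \<open>R\<close>, and it reduces a claim that a generated
  ideal multiplies \<open>x\<close> into \<open>U\<close> to a check on generators.\<close>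

lemma colon_ideal:
  assumes U: "ideal U R" and x: "x \<in> carrier R"
  shows "ideal {s \<in> carrier R. s \<otimes> x \<in> U} R"
proof (rule idealI[OF ring_axioms])
  interpret U: ideal U R by fact
  show "subgroup {s \<in> carrier R. s \<otimes> x \<in> U} (add_monoid R)"
    by (rule subgroup.intro) (auto simp: x l_distr l_minus simp flip: a_inv_def)
  fix a s assume a: "a \<in> {s \<in> carrier R. s \<otimes> x \<in> U}" and s: "s \<in> carrier R"
  have "(s \<otimes> a) \<otimes> x = s \<otimes> (a \<otimes> x)" using a s x by (simp add: m_assoc)
  then show "s \<otimes> a \<in> {s \<in> carrier R. s \<otimes> x \<in> U}" using a s U.I_l_closed by simp
  then show "a \<otimes> s \<in> {s \<in> carrier R. s \<otimes> x \<in> U}" using a s by (simp add: m_comm)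
qed

text \<open>By the modular law, an ideal is determined within a chain by its meet and its join with a
  fixed ideal, so the sum of the two ranks is strictly monotone.\<close>
lemma length_at_most_trans:
  assumes B: "ideal B R" and AB: "A \<subseteq> B" and BC: "B \<subseteq> C" and C: "ideal C R"
    and 1: "length_at_most R A B b1" and 2: "length_at_most R B C b2"
  shows "length_at_most R A C (b1 + b2)"
proof -
  obtain r1 where "ideal_rank R A B b1 r1"
    using 1 unfolding length_at_most_def by blast
  note r1 = ideal_rank_less[OF this] ideal_rank_le[OF this]
  obtain r2 where "ideal_rank R B C b2 r2"
    using 2 unfolding length_at_most_def by blast
  note r2 = ideal_rank_less[OF this] ideal_rank_le[OF this]
  have meet: "ideal (U \<inter> B) R" "U \<inter> B \<subseteq> B" if "ideal U R" for U
    using that B i_intersect by auto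
  have join: "ideal (U <+>\<^bsub>R\<^esub> B) R" "B \<subseteq> U <+>\<^bsub>R\<^esub> B" "U \<subseteq> C \<Longrightarrow> U <+>\<^bsub>R\<^esub> B \<subseteq> C" if "ideal U R" for U
  proof -
    show "ideal (U <+>\<^bsub>R\<^esub> B) R" using that B by (rule add_ideals)
    show "B \<subseteq> U <+>\<^bsub>R\<^esub> B" "U \<subseteq> C \<Longrightarrow> U <+>\<^bsub>R\<^esub> B \<subseteq> C"
      using union_genideal[OF that B] genideal_self[of "U \<union> B"] genideal_minimal[OF C, of "U \<union> B"]
        ideal_subset_carrier[OF that] ideal_subset_carrier[OF B] BC by auto
  qed
  show ?thesis
  proof (rule length_at_mostI[of R _ _ "\<lambda>U. r1 (U \<inter> B) + r2 (U <+>\<^bsub>R\<^esub> B)"])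
    fix U V assume U: "ideal U R" and V: "ideal V R" and AX: "A \<subseteq> U" and XY: "U \<subset> V" and YC: "V \<subseteq> C"
    have sub: "U \<inter> B \<subseteq> V \<inter> B" "U <+>\<^bsub>R\<^esub> B \<subseteq> V <+>\<^bsub>R\<^esub> B"
      using XY unfolding set_add_def' by auto
    have "U \<inter> B \<subset> V \<inter> B \<or> U <+>\<^bsub>R\<^esub> B \<subset> V <+>\<^bsub>R\<^esub> B"
    proof (rule ccontr)
      assume "\<not> ?thesis"
      with sub have eq: "U \<inter> B = V \<inter> B" "U <+>\<^bsub>R\<^esub> B = V <+>\<^bsub>R\<^esub> B" by auto
      have "V \<subseteq> U"
      proof
        fix y assume y: "y \<in> V"
        have "V \<subseteq> V <+>\<^bsub>R\<^esub> B"
          using union_genideal[OF V B] genideal_self[of "V \<union> B"]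
            ideal_subset_carrier[OF V] ideal_subset_carrier[OF B] by auto
        then have "y \<in> U <+>\<^bsub>R\<^esub> B" unfolding eq(2) by (rule subsetD) (rule y)
        then have "\<exists>x\<in>U. \<exists>b\<in>B. y = x \<oplus> b" unfolding set_add_def' by simp
        then obtain x b where xb: "x \<in> U" "b \<in> B" "y = x \<oplus> b" by blast
        from B xb(2) have "b \<in> carrier R" by (rule ideal.Icarr)
        moreover have "x \<in> V" using xb(1) psubset_imp_subset[OF XY] by (rule subsetD[rotated])
        ultimately have "b \<in> V" using ideal_add_cancel_left[OF V, of x b] y xb(3) by simp
        then have "b \<in> U" using xb eq(1) by blast
        then show "y \<in> U" using xb U ideal_add by blast
      qed
      with XY show False by blast
    qed
    moreover have "r1 (U \<inter> B) < r1 (V \<inter> B)" if "U \<inter> B \<subset> V \<inter> B"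
      using r1(1)[OF meet(1)[OF U] meet(1)[OF V]] that AX AB by blast
    moreover have "r2 (U <+>\<^bsub>R\<^esub> B) < r2 (V <+>\<^bsub>R\<^esub> B)" if "U <+>\<^bsub>R\<^esub> B \<subset> V <+>\<^bsub>R\<^esub> B"
      using r2(1)[OF join(1)[OF U] join(1)[OF V] join(2)[OF U] that join(3)[OF V YC]] .
    moreover have "r1 (U \<inter> B) \<le> r1 (V \<inter> B)" "r2 (U <+>\<^bsub>R\<^esub> B) \<le> r2 (V <+>\<^bsub>R\<^esub> B)"
      using calculation sub by (metis less_imp_le order_refl psubsetI)+
    ultimately show "r1 (U \<inter> B) + r2 (U <+>\<^bsub>R\<^esub> B) < r1 (V \<inter> B) + r2 (V <+>\<^bsub>R\<^esub> B)"
      by linarith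
  next
    fix U assume U: "ideal U R" and AX: "A \<subseteq> U" and XC: "U \<subseteq> C"
    show "r1 (U \<inter> B) + r2 (U <+>\<^bsub>R\<^esub> B) \<le> b1 + b2"
      using r1(2)[OF meet(1)[OF U]] r2(2)[OF join(1)[OF U] join(2)[OF U] join(3)[OF U XC]] AX AB
      by (intro add_mono) auto
  qed
qed

text \<open>The module \<open>(A + Rx) / A\<close> is a quotient of \<open>R / B\<close>.\<close>
lemma length_at_most_insert:
  assumes A: "ideal A R" and x: "x \<in> carrier R" and B: "\<And>w. w \<in> B \<Longrightarrow> w \<in> carrier R \<and> w \<otimes> x \<in> A"
    and len: "length_at_most R B (carrier R) c"
  shows "length_at_most R A (Idl (insert x A)) c"
proof -
  define q where "q U = {s \<in> carrier R. s \<otimes> x \<in> U}" for U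
  obtain r where "ideal_rank R B (carrier R) c r"
    using len unfolding length_at_most_def by blast
  note r = ideal_rank_less[OF this] ideal_rank_le[OF this]
  have q: "ideal (q U) R" "q U \<subseteq> carrier R" if "ideal U R" for U
    using colon_ideal[OF that x] unfolding q_def by auto
  have Bq: "B \<subseteq> q U" if "A \<subseteq> U" for U
    using B that unfolding q_def by blast
  show ?thesis
  proof (rule length_at_mostI[of R _ _ "\<lambda>U. r (q U)"])
    fix U V assume U: "ideal U R" and V: "ideal V R" and AX: "A \<subseteq> U" and XY: "U \<subset> V"
      and YC: "V \<subseteq> Idl (insert x A)"
    obtain y where y: "y \<in> V" "y \<notin> U" using XY by blast
    with YC obtain a s where as: "a \<in> A" "s \<in> carrier R" "y = a \<oplus> s \<otimes> x"
      using genideal_insertE[OF A x] by blast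
    \<comment> \<open>As \<open>a\<close> lies in both ideals, \<open>s \<otimes> x\<close>
      separates them just as \<open>y\<close> does, so \<open>s\<close> separates the two colon
      ideals.\<close>
    have "s \<otimes> x \<in> V"
      using ideal_add_cancel_left[OF V, of a "s \<otimes> x"] as y AX XY x by auto
    moreover have "s \<otimes> x \<notin> U" using as y AX ideal_add[OF U] by blast
    ultimately have "q U \<subset> q V" using XY as(2) unfolding q_def by blast
    then show "r (q U) < r (q V)" using r(1)[OF q(1)[OF U] q(1)[OF V] Bq[OF AX]] q(2)[OF V] by blast
  next
    fix U assume U: "ideal U R" and AX: "A \<subseteq> U"
    then show "r (q U) \<le> c" using r(2) q Bq by blast
  qed
qed

text \<open>The generators are adjoined one at a time. Each adds a cyclic factor still annihilated
  by \<open>B\<close>, hence of length at most \<open>c\<close>.\<close>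

lemma length_at_most_generators:
  assumes "finite F" "F \<subseteq> carrier R" and A: "ideal A R"
    and B: "\<And>w x. w \<in> B \<Longrightarrow> x \<in> F \<Longrightarrow> w \<in> carrier R \<and> w \<otimes> x \<in> A"
    and len: "length_at_most R B (carrier R) c"
  shows "length_at_most R A (Idl (A \<union> F)) (card F * c)"
  using assms(1,2) B
proof (induction F rule: finite_induct)
  case empty
  have "Idl A = A" using genideal_minimal[OF A, of A] genideal_self[OF ideal_subset_carrier[OF A]] by auto
  then show ?case by (simp add: length_at_most_refl)
next
  case (insert x F)
  define A' where "A' = Idl (A \<union> F)"
  have carr: "A \<union> F \<subseteq> carrier R" using insert.prems ideal_subset_carrier[OF A] by auto
  have A': "ideal A' R" unfolding A'_def by (rule genideal_ideal[OF carr])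
  have AA': "A \<union> F \<subseteq> A'" unfolding A'_def by (rule genideal_self[OF carr])
  have x: "x \<in> carrier R" using insert.prems by auto
  have "length_at_most R A' (Idl (insert x A')) c"
    by (rule length_at_most_insert[OF A' x _ len]) (use insert.prems AA' in blast)
  moreover have "length_at_most R A A' (card F * c)"
    unfolding A'_def using insert by blast
  moreover have I: "ideal (Idl (insert x A')) R" "insert x A' \<subseteq> Idl (insert x A')"
    using genideal_ideal[of "insert x A'"] genideal_self[of "insert x A'"] ideal_subset_carrier[OF A'] x by blast+
  ultimately have "length_at_most R A (Idl (insert x A')) (card F * c + c)"
    using AA' by (intro length_at_most_trans[OF A' _ _ I(1)]) auto
  moreover have "Idl (A \<union> insert x F) \<subseteq> Idl (insert x A')"
    using I AA' by (intro genideal_minimal) auto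
  ultimately show ?case using insert.hyps by (auto intro: length_at_most_mono)
qed

end

section \<open>Products of prime ideals\<close>

context cring
begin

abbreviation ideal_prod_list :: "'a set list \<Rightarrow> 'a set" where
  "ideal_prod_list Is \<equiv> foldr (ideal_prod R) Is (carrier R)"

lemma ideal_prod_list_ideal: "(\<And>I. I \<in> set Is \<Longrightarrow> ideal I R) \<Longrightarrow> ideal (ideal_prod_list Is) R"
  by (induction Is) (auto intro: oneideal ideal_prod_is_ideal)

lemma ideal_prod_subset:
  assumes "ideal K R" "\<And>i j. i \<in> I \<Longrightarrow> j \<in> J \<Longrightarrow> i \<otimes> j \<in> K"
  shows "ideal_prod R I J \<subseteq> K"
proof
  fix s assume "s \<in> ideal_prod R I J"
  then show "s \<in> K" by induction (auto simp: assms ideal_add)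
qed

lemma ideal_prod_mono: "I \<subseteq> I' \<Longrightarrow> J \<subseteq> J' \<Longrightarrow> ideal_prod R I J \<subseteq> ideal_prod R I' J'"
proof
  fix s assume "I \<subseteq> I'" "J \<subseteq> J'" "s \<in> ideal_prod R I J"
  from this(3,1,2) show "s \<in> ideal_prod R I' J'" by induction (auto intro: ideal_prod.intros)
qed

lemma ideal_prod_list_append:
  assumes "\<And>I. I \<in> set Is \<Longrightarrow> ideal I R" "\<And>I. I \<in> set Js \<Longrightarrow> ideal I R"
  shows "ideal_prod_list (Is @ Js) = ideal_prod R (ideal_prod_list Is) (ideal_prod_list Js)"
  using assms(1)
proof (induction Is)
  case Nil
  have "ideal (ideal_prod_list Js) R" using assms(2) by (rule ideal_prod_list_ideal)
  then show ?case using ideal_prod_one[of "ideal_prod_list Js"]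
      ideal_prod_commute[OF oneideal, of "ideal_prod_list Js"] by simp
next
  case (Cons I Is)
  then show ?case using ideal_prod_assoc ideal_prod_list_ideal assms(2) by auto
qed

text \<open>The two-factor property of primes is applied along the list. The empty product is the
  whole ring, which no prime ideal contains, so the list cannot run out.\<close>

lemma ideal_prod_list_subset_primeideal:
  assumes "primeideal P R" "\<And>I. I \<in> set Is \<Longrightarrow> ideal I R" "ideal_prod_list Is \<subseteq> P"
  shows "\<exists>I\<in>set Is. I \<subseteq> P"
  using assms(2,3)
proof (induction Is)
  case Nil
  then show ?case
    using primeideal.I_notcarr[OF assms(1)] ideal_subset_carrier[OF primeideal.axioms(1)[OF assms(1)]] by auto
next
  case (Cons I Is)
  then have "I \<subseteq> P \<or> ideal_prod_list Is \<subseteq> P"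
    using primeideal_divides_ideal_prod[OF assms(1), of I "ideal_prod_list Is"]
      ideal_prod_list_ideal[of Is] by simp
  then show ?case using Cons by auto
qed

lemma primeideal_pow:
  assumes "primeideal P R" "x \<in> carrier R" "x [^] (k :: nat) \<in> P"
  shows "x \<in> P"
  using assms(3)
proof (induction k)
  case 0
  then show ?case
    using ideal.one_imp_carrier[OF primeideal.axioms(1)[OF assms(1)]] primeideal.I_notcarr[OF assms(1)] by auto
next
  case (Suc k)
  then show ?case using primeideal.I_prime[OF assms(1), of "x [^] k" x] assms(2) by auto
qed

text \<open>The preimage of \<open>J\<close> is an ideal, so it suffices to test generators.\<close>

lemma ring_hom_image_subset:
  assumes g: "g \<in> ring_hom R R" and J: "ideal J R" and S: "S \<subseteq> carrier R" "g ` S \<subseteq> J"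
  shows "g ` (Idl S) \<subseteq> J"
proof -
  interpret g: ring_hom_ring R R g by (rule ring_hom_ringI2[OF ring_axioms ring_axioms g])
  have "Idl S \<subseteq> {r \<in> carrier R. g r \<in> J}"
    using S by (intro genideal_minimal g.ideal_vimage J) auto
  then show ?thesis by blast
qed

lemma ideal_prod_list_mono:
  "list_all2 (\<subseteq>) Is Js \<Longrightarrow> ideal_prod_list Is \<subseteq> ideal_prod_list Js"
  by (induction rule: list_all2_induct) (simp_all add: ideal_prod_mono)

end

section \<open>Noetherian induction and minimal primes\<close>

locale noetherian_cring = cring + noetherian_ring

context noetherian_cring
begin

text \<open>Zorn's lemma applies to an arbitrary nonempty family: in a Noetherian ring a nonempty
  chain of ideals contains its own union, so the family need not be closed under unions.\<close>

lemma maximal_ideal_exists: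
  assumes "S \<noteq> {}" "\<And>I. I \<in> S \<Longrightarrow> ideal I R"
  shows "\<exists>M\<in>S. \<forall>I\<in>S. M \<subseteq> I \<longrightarrow> I = M"
proof (rule subset_Zorn)
  fix C assume C: "subset.chain S C"
  show "\<exists>U\<in>S. \<forall>I\<in>C. I \<subseteq> U"
  proof (cases "C = {}")
    case False
    have "subset.chain {I. ideal I R} C"
      using C assms(2) unfolding pred_on.chain_def by blast
    with False have "\<Union>C \<in> C" by (rule ideal_chain_is_trivial)
    then have "\<Union>C \<in> S" using C unfolding pred_on.chain_def by (elim conjE subsetD)
    then show ?thesis by (rule bexI[rotated]) (simp add: Union_upper)
  qed (use assms(1) in auto)
qed

text \<open>Noetherian induction. A maximal counterexample \<open>M\<close> is neither the whole
  ring nor prime, so \<open>x \<otimes> y \<in> M\<close> with both factors outside. The ideals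
  \<open>M + Rx\<close> and \<open>M + Ry\<close> then contain products of primes, and concatenating
  the two lists gives a product inside \<open>M\<close>.\<close>

lemma ideal_contains_prime_product:
  assumes "ideal I R"
  shows "\<exists>Ps. (\<forall>P\<in>set Ps. primeideal P R \<and> I \<subseteq> P) \<and> ideal_prod_list Ps \<subseteq> I"
proof (rule ccontr)
  define good where
    "good I \<longleftrightarrow> (\<exists>Ps. (\<forall>P\<in>set Ps. primeideal P R \<and> I \<subseteq> P) \<and> ideal_prod_list Ps \<subseteq> I)" for I
  assume "\<not> ?thesis"
  then have "{I. ideal I R \<and> \<not> good I} \<noteq> {}" using assms unfolding good_def by blast
  then obtain M where M: "ideal M R" "\<not> good M"
    and max: "\<And>I. ideal I R \<Longrightarrow> M \<subset> I \<Longrightarrow> good I"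
    using maximal_ideal_exists[of "{I. ideal I R \<and> \<not> good I}"] by blast
  \<comment> \<open>The empty list serves for the whole ring.\<close>
  have "M \<noteq> carrier R" using M(2) unfolding good_def by (auto dest: spec[of _ "[]"])
  moreover have "\<not> primeideal M R"
  proof
    assume "primeideal M R"
    then have "good M" unfolding good_def using ideal_prod_one[OF M(1)] by (intro exI[of _ "[M]"]) simp
    with M(2) show False ..
  qed
  ultimately obtain x y where xy: "x \<in> carrier R" "y \<in> carrier R" "x \<otimes> y \<in> M" "x \<notin> M" "y \<notin> M"
    using primeidealI[OF M(1) is_cring] by metis
  have carr: "insert x M \<subseteq> carrier R" "insert y M \<subseteq> carrier R"
    using xy ideal_subset_carrier[OF M(1)] by auto
  note I = genideal_ideal[OF carr(1)] genideal_ideal[OF carr(2)]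
  note S = genideal_self[OF carr(1)] genideal_self[OF carr(2)]
  have "good (Idl (insert x M))" "good (Idl (insert y M))"
    using max I S xy(4,5) by auto
  then obtain Ps Qs where
    Ps: "\<And>P. P \<in> set Ps \<Longrightarrow> primeideal P R \<and> Idl (insert x M) \<subseteq> P" "ideal_prod_list Ps \<subseteq> Idl (insert x M)"
    and Qs: "\<And>P. P \<in> set Qs \<Longrightarrow> primeideal P R \<and> Idl (insert y M) \<subseteq> P" "ideal_prod_list Qs \<subseteq> Idl (insert y M)"
    unfolding good_def by metis
  have "ideal_prod_list (Ps @ Qs) = ideal_prod R (ideal_prod_list Ps) (ideal_prod_list Qs)"
    by (rule ideal_prod_list_append) (meson Ps(1) Qs(1) primeideal.axioms(1))+
  also have "\<dots> \<subseteq> ideal_prod R (Idl (insert x M)) (Idl (insert y M))"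
    using Ps(2) Qs(2) by (rule ideal_prod_mono)
  also have "\<dots> \<subseteq> M"
  proof (rule ideal_prod_subset[OF M(1)])
    fix i j assume "i \<in> Idl (insert x M)" "j \<in> Idl (insert y M)"
    then obtain a s b t where i: "a \<in> M" "s \<in> carrier R" "i = a \<oplus> s \<otimes> x"
      and j: "b \<in> M" "t \<in> carrier R" "j = b \<oplus> t \<otimes> y"
      using genideal_insertE[OF M(1)] xy(1,2) by metis
    have carr: "a \<in> carrier R" "b \<in> carrier R" using i j ideal.Icarr[OF M(1)] by auto
    \<comment> \<open>Every summand has a factor in \<open>M\<close>: \<open>a\<close>,
      \<open>b\<close> or \<open>x \<otimes> y\<close>.\<close>
    have "i \<otimes> j = (a \<otimes> j) \<oplus> (((s \<otimes> x) \<otimes> b) \<oplus> ((s \<otimes> t) \<otimes> (x \<otimes> y)))"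
      unfolding i j using carr i(2) j(2) xy(1,2) by algebra
    also have "\<dots> \<in> M"
      using i j carr xy ideal.I_l_closed[OF M(1)] ideal.I_r_closed[OF M(1)]
      by (intro ideal_add[OF M(1)]) auto
    finally show "i \<otimes> j \<in> M" .
  qed
  finally have "ideal_prod_list (Ps @ Qs) \<subseteq> M" .
  moreover have "primeideal P R \<and> M \<subseteq> P" if "P \<in> set (Ps @ Qs)" for P
    using that Ps(1)[of P] Qs(1)[of P] S by auto
  ultimately have "good M" unfolding good_def by blast
  with M(2) show False ..
qed

text \<open>Every prime contains the zero product and therefore one of the listed primes. Hence a
  minimal prime must be listed, and a listed prime that is minimal within the list is minimal among
  all primes.\<close>

lemma minimal_prime_below_product:
  assumes Ps: "\<And>P. P \<in> set Ps \<Longrightarrow> primeideal P R" and "ideal_prod_list Ps \<subseteq> {\<zero>}"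
  shows "minimal_primes R \<subseteq> set Ps" and "P \<in> set Ps \<Longrightarrow> \<exists>Q\<in>minimal_primes R. Q \<subseteq> P"
proof -
  have below: "\<exists>Q\<in>set Ps. Q \<subseteq> P" if "primeideal P R" for P
  proof (rule ideal_prod_list_subset_primeideal[OF that])
    show "ideal_prod_list Ps \<subseteq> P"
      using assms(2) additive_subgroup.zero_closed ideal.axioms(1) primeideal.axioms(1)[OF that] by fast
  qed (use Ps primeideal.axioms(1) in blast)
  show "minimal_primes R \<subseteq> set Ps"
    using below Ps unfolding minimal_primes_def by blast
  assume "P \<in> set Ps"
  then obtain Q where Q: "Q \<in> set Ps" "Q \<subseteq> P" and min: "\<And>Q'. Q' \<in> set Ps \<Longrightarrow> Q' \<subseteq> Q \<Longrightarrow> Q' = Q"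
    using finite_has_minimal2[of "set Ps" P] by auto
  have "Q' = Q" if "primeideal Q' R" "Q' \<subseteq> Q" for Q'
    using below[OF that(1)] min that(2) by blast
  then have "Q \<in> minimal_primes R" using Q(1) Ps unfolding minimal_primes_def by blast
  with Q(2) show "\<exists>Q\<in>minimal_primes R. Q \<subseteq> P" by blast
qed

lemma finite_minimal_primes: "finite (minimal_primes R)"
  using ideal_contains_prime_product[OF zeroideal] minimal_prime_below_product(1)
  by (meson finite_set finite_subset)

text \<open>Replacing each prime of a vanishing product by a minimal prime below it only shrinks the
  product.\<close>

lemma zero_eq_minimal_prime_product:
  "\<exists>Ps. set Ps \<subseteq> minimal_primes R \<and> ideal_prod_list Ps \<subseteq> {\<zero>}"
proof -
  obtain Ps where Ps: "\<And>P. P \<in> set Ps \<Longrightarrow> primeideal P R" "ideal_prod_list Ps \<subseteq> {\<zero>}"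
    using ideal_contains_prime_product[OF zeroideal] by blast
  obtain f where f: "\<And>P. P \<in> set Ps \<Longrightarrow> f P \<in> minimal_primes R \<and> f P \<subseteq> P"
    using minimal_prime_below_product(2)[OF Ps] by metis
  have "ideal_prod_list (map f Ps) \<subseteq> ideal_prod_list Ps"
    using f by (intro ideal_prod_list_mono) (auto simp: list_all2_conv_all_nth)
  with Ps(2) f show ?thesis by (intro exI[of _ "map f Ps"]) auto
qed

text \<open>The filtration of \<open>R\<close> by partial products has finitely generated factors, each
  annihilated by one of the ideals. The constant does not depend on \<open>I\<close>.\<close>
lemma length_at_most_product:
  assumes "\<And>P. P \<in> set Ps \<Longrightarrow> ideal P R"
  shows "\<exists>C. \<forall>I b. ideal I R \<longrightarrow> ideal_prod_list Ps \<subseteq> I \<longrightarrow>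
    (\<forall>P\<in>set Ps. length_at_most R (Idl (I \<union> P)) (carrier R) b) \<longrightarrow>
    length_at_most R I (carrier R) (C * b)"
  using assms
proof (induction Ps)
  case Nil
  then show ?case
    by (intro exI[of _ 0]) (auto intro: length_at_most_mono[OF length_at_most_refl[of R "carrier R"]])
next
  case (Cons P Ps)
  define Q where "Q = ideal_prod_list Ps"
  have Q: "ideal Q R" and P: "ideal P R"
    unfolding Q_def using Cons.prems by (auto intro!: ideal_prod_list_ideal)
  obtain C where C: "\<And>I b. ideal I R \<Longrightarrow> Q \<subseteq> I \<Longrightarrow>
      (\<And>P. P \<in> set Ps \<Longrightarrow> length_at_most R (Idl (I \<union> P)) (carrier R) b) \<Longrightarrow>
      length_at_most R I (carrier R) (C * b)"
    using Cons unfolding Q_def by (metis list.set_intros(2))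
  \<comment> \<open>\<open>F\<close> depends on the list of ideals alone; this is what makes the
    constant \<open>card F + C\<close> uniform in \<open>I\<close> and \<open>b\<close>.\<close>
  obtain F where F: "F \<subseteq> carrier R" "finite F" "Q = Idl F"
    using finetely_gen[OF Q] by blast
  have "length_at_most R I (carrier R) ((card F + C) * b)"
    if I: "ideal I R" and PQ: "ideal_prod R P Q \<subseteq> I"
      and len: "\<And>P'. P' \<in> set (P # Ps) \<Longrightarrow> length_at_most R (Idl (I \<union> P')) (carrier R) b" for I b
  proof -
    \<comment> \<open>\<open>J\<close> is \<open>I + Q\<close>. The factor \<open>J / I\<close> is
      generated by \<open>F\<close> and killed by \<open>I + P\<close>, since \<open>PQ\<close> lies
      in \<open>I\<close>; above \<open>J\<close> the induction hypothesis applies.\<close>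
    define J where "J = Idl (I \<union> F)"
    have IF: "I \<union> F \<subseteq> carrier R" using F ideal_subset_carrier[OF I] by auto
    have J: "ideal J R" "I \<union> F \<subseteq> J" unfolding J_def using genideal_ideal[OF IF] genideal_self[OF IF] by auto
    have JP: "J \<union> P' \<subseteq> carrier R" if "P' \<in> set (P # Ps)" for P'
      using ideal_subset_carrier[OF J(1)] Cons.prems[OF that] ideal_subset_carrier by auto
    have IP: "I \<union> P \<subseteq> carrier R" using ideal_subset_carrier[OF I] ideal_subset_carrier[OF P] by auto
    have "length_at_most R I J (card F * b)"
      unfolding J_def
    proof (rule length_at_most_generators[OF F(2,1) I, where B = "Idl (I \<union> P)"])
      fix w x assume w: "w \<in> Idl (I \<union> P)" and x: "x \<in> F"
      have xR: "x \<in> carrier R" and xQ: "x \<in> Q" using x F genideal_self[OF F(1)] by auto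
      have "Idl (I \<union> P) \<subseteq> {w \<in> carrier R. w \<otimes> x \<in> I}"
      proof (rule genideal_minimal[OF colon_ideal[OF I xR]])
        have "w \<otimes> x \<in> I" if "w \<in> P" for w
          using PQ ideal_prod.prod[OF that xQ, of R] by blast
        moreover have "w \<otimes> x \<in> I" if "w \<in> I" for w
          using ideal.I_r_closed[OF I that xR] .
        ultimately show "I \<union> P \<subseteq> {w \<in> carrier R. w \<otimes> x \<in> I}" using IP by blast
      qed
      then show "w \<in> carrier R \<and> w \<otimes> x \<in> I" using w by blast
    qed (use len in simp)
    moreover have "length_at_most R J (carrier R) (C * b)"
    proof (rule C[OF J(1)])
      show "Q \<subseteq> J" unfolding F(3) using J by (intro genideal_minimal) auto
      fix P' assume P': "P' \<in> set Ps"
      then have "Idl (I \<union> P') \<subseteq> Idl (J \<union> P')"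
        using J(2) JP[of P'] by (intro subset_Idl_subset) auto
      then show "length_at_most R (Idl (J \<union> P')) (carrier R) b"
        using len[of P'] P' by (auto intro: length_at_most_mono)
    qed
    ultimately show ?thesis
      using length_at_most_trans[OF J(1) _ _ oneideal, of I "card F * b" "C * b"] J
        ideal_subset_carrier[OF J(1)] by (simp add: add_mult_distrib)
  qed
  then show ?case unfolding Q_def foldr_Cons o_apply by (intro exI[of _ "card F + C"] allI impI) blast
qed

end

section \<open>Length of quotient rings\<close>

text \<open>A rank function increases by at least one at each step of a chain, which bounds chain
  lengths. Conversely, if chain lengths are bounded, the greatest length of a chain from
  \<open>I\<close> to \<open>U\<close> is a rank function.\<close>

lemma length_quot_le_iff:
  assumes I: "ideal I R"
  shows "length_quot R I \<le> enat b \<longleftrightarrow> length_at_most R I (carrier R) b"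
proof -
  interpret ideal I R by fact
  define K where "K U = {k. \<exists>J :: nat \<Rightarrow> 'a set.
      (\<forall>i\<le>k. ideal (J i) R) \<and> J 0 = I \<and> J k = U \<and> (\<forall>i<k. J i \<subset> J (Suc i))}" for U
  have lq: "length_quot R I = Sup (enat ` K (carrier R))"
    unfolding length_quot_def K_def by (rule arg_cong[where f = Sup]) auto
  have sub: "U \<subseteq> carrier R" if "ideal U R" for U
    using that by (meson additive_subgroup.a_subset ideal.axioms(1))
  show ?thesis
  proof
    assume "length_at_most R I (carrier R) b"
    then obtain r where r: "ideal_rank R I (carrier R) b r" unfolding length_at_most_def by blast
    have "k \<le> b" if "k \<in> K (carrier R)" for k
    proof -
      from that obtain J :: "nat \<Rightarrow> 'a set" where J: "\<And>i. i \<le> k \<Longrightarrow> ideal (J i) R" "J 0 = I"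
        "J k = carrier R" "\<And>i. i < k \<Longrightarrow> J i \<subset> J (Suc i)"
        unfolding K_def by auto
      have "I \<subseteq> J i \<and> i \<le> r (J i)" if "i \<le> k" for i
        using that
      proof (induction i)
        case (Suc i)
        then have "r (J i) < r (J (Suc i))"
          using J sub by (intro ideal_rank_less[OF r]) auto
        then show ?case using Suc J(4)[of i] by auto
      qed (simp add: J)
      then show "k \<le> b"
        using ideal_rank_le[OF r J(1)[of k]] J(3) by force
    qed
    then show "length_quot R I \<le> enat b" unfolding lq by (auto intro!: Sup_least)
  next
    assume "length_quot R I \<le> enat b"
    then have top: "k \<le> b" if "k \<in> K (carrier R)" for k
      using that unfolding lq by (metis Sup_upper enat_ord_simps(1) imageI order_trans)
    have step: "Suc k \<in> K V" if k: "k \<in> K U" and V: "ideal V R" "U \<subset> V" for k U V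
    proof -
      from k obtain J :: "nat \<Rightarrow> 'a set" where J: "\<And>i. i \<le> k \<Longrightarrow> ideal (J i) R" "J 0 = I"
        "J k = U" "\<And>i. i < k \<Longrightarrow> J i \<subset> J (Suc i)"
        unfolding K_def by auto
      show ?thesis
        unfolding K_def using J V
        by (intro CollectI exI[of _ "J(Suc k := V)"]) (auto simp: less_Suc_eq le_Suc_eq)
    qed
    \<comment> \<open>A chain ending at a proper ideal can be prolonged by the whole ring, so the
      bound for full chains also bounds partial ones and makes each \<open>K U\<close>
      finite.\<close>
    have bound: "k \<le> b" if "k \<in> K U" "ideal U R" for k U
    proof (cases "U = carrier R")
      case False
      then have "Suc k \<in> K (carrier R)"
        using step[OF that(1) oneideal] sub[OF that(2)] by blast
      then show ?thesis using top by fastforce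
    qed (use that top in simp)
    have fin: "finite (K U)" if "ideal U R" for U
      using bound[OF _ that] by (meson finite_nat_set_iff_bounded_le)
    have K0: "0 \<in> K I" unfolding K_def using I by (auto intro!: exI[of _ "\<lambda>_. I"])
    have ne: "K U \<noteq> {}" if "ideal U R" "I \<subseteq> U" for U
      using step[OF K0 that(1)] that(2) K0 by (cases "U = I") auto
    show "length_at_most R I (carrier R) b"
    proof (rule length_at_mostI[of R _ _ "\<lambda>U. Max (K U)"])
      fix U V assume U: "ideal U R" and V: "ideal V R" and "I \<subseteq> U" "U \<subset> V"
      then have "Suc (Max (K U)) \<in> K V" using step[OF Max_in[OF fin[OF U] ne[OF U]] V] by simp
      then show "Max (K U) < Max (K V)" using Max_ge[OF fin[OF V]] by fastforce
    next
      fix U assume U: "ideal U R" "I \<subseteq> U"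
      show "Max (K U) \<le> b" using Max_in[OF fin ne] U bound by blast
    qed
  qed
qed

text \<open>Any finite bound makes the length a natural number, the least such bound, so that
  \<open>the_enat\<close> later returns the true value.\<close>

lemma length_quot_eq_enat:
  assumes "ideal I R" "length_at_most R I (carrier R) b"
  shows "\<exists>l. length_quot R I = enat l \<and> (\<forall>c. length_at_most R I (carrier R) c \<longleftrightarrow> l \<le> c)"
proof -
  have "length_quot R I \<le> enat b" using assms length_quot_le_iff by blast
  then obtain l where l: "length_quot R I = enat l" by (cases "length_quot R I") auto
  then show ?thesis using length_quot_le_iff[OF assms(1)] by simp
qed

text \<open>Quotients by \<open>P\<close>: ideals are transported along \<open>\<Union>\<close>, the preimage under \<open>R \<rightarrow> R / P\<close>.\<close>

context cring
begin

lemma Union_quot_image: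
  assumes "ideal P R" "ideal J R" "P \<subseteq> J"
  shows "\<Union> ((+>) P ` J) = J"
  using ideal_incl_iff[OF assms(1,2)] assms(3) by simp

lemma quot_image_Union:
  assumes P: "ideal P R" and K: "ideal K (R Quot P)"
  shows "(+>) P ` (\<Union> K) = K" "ideal (\<Union> K) R" "P \<subseteq> \<Union> K"
proof -
  have "K \<in> (\<lambda>J. (+>) P ` J) ` {J. ideal J R \<and> P \<subseteq> J}"
    using quot_ideal_correspondence[OF P] K unfolding bij_betw_def by blast
  then obtain J where J: "K = (+>) P ` J" "ideal J R" "P \<subseteq> J" by blast
  have "\<Union> K = J" unfolding J(1) by (rule Union_quot_image[OF P J(2,3)])
  then show "(+>) P ` (\<Union> K) = K" "ideal (\<Union> K) R" "P \<subseteq> \<Union> K" using J by auto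
qed

lemma quot_carrier: "carrier (R Quot P) = (+>) P ` carrier R"
  unfolding FactRing_def A_RCOSETS_def' by auto

lemma Union_quot_carrier:
  assumes "ideal P R" shows "\<Union> (carrier (R Quot P)) = carrier R"
  unfolding quot_carrier using Union_quot_image[OF assms oneideal] ideal_subset_carrier[OF assms] .

text \<open>Rank functions are composed with the ideal correspondence in either direction; its
  injectivity preserves strict inclusions.\<close>

lemma length_at_most_quot_iff:
  assumes P: "ideal P R" and K: "ideal K (R Quot P)"
  shows "length_at_most (R Quot P) K (carrier (R Quot P)) b \<longleftrightarrow> length_at_most R (\<Union> K) (carrier R) b"
proof
  assume "length_at_most (R Quot P) K (carrier (R Quot P)) b"
  then obtain r where r: "ideal_rank (R Quot P) K (carrier (R Quot P)) b r"
    unfolding length_at_most_def by blast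
  have img: "K \<subseteq> (+>) P ` U" if "\<Union> K \<subseteq> U" for U
    using image_mono[OF that, of "(+>) P"] by (simp only: quot_image_Union(1)[OF P K])
  have PU: "P \<subseteq> U" if "\<Union> K \<subseteq> U" for U
    using quot_image_Union(3)[OF P K] that by simp
  show "length_at_most R (\<Union> K) (carrier R) b"
  proof (rule length_at_mostI[of R _ _ "\<lambda>U. r ((+>) P ` U)"])
    fix U V assume U: "ideal U R" and V: "ideal V R" and KU: "\<Union> K \<subseteq> U" and UV: "U \<subset> V"
    have "\<Union> K \<subseteq> V" using KU UV by simp
    have "(+>) P ` U \<noteq> (+>) P ` V"
    proof
      assume "(+>) P ` U = (+>) P ` V"
      then have "\<Union> ((+>) P ` U) = \<Union> ((+>) P ` V)" by (rule arg_cong)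
      then have "U = V"
        unfolding Union_quot_image[OF P U PU[OF KU]] Union_quot_image[OF P V PU[OF \<open>\<Union> K \<subseteq> V\<close>]] .
      with UV show False by simp
    qed
    then have "(+>) P ` U \<subset> (+>) P ` V"
      using image_mono[OF psubset_imp_subset[OF UV], of "(+>) P"] by (rule psubsetI[rotated])
    then show "r ((+>) P ` U) < r ((+>) P ` V)"
      using ideal_subset_carrier[OF V]
      by (intro ideal_rank_less[OF r] ring_ideal_imp_quot_ideal P U V img KU) (simp_all add: quot_carrier image_mono)
  next
    fix U assume U: "ideal U R" and KU: "\<Union> K \<subseteq> U"
    show "r ((+>) P ` U) \<le> b"
      using ideal_subset_carrier[OF U]
      by (intro ideal_rank_le[OF r] ring_ideal_imp_quot_ideal P U img KU) (simp add: quot_carrier image_mono)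
  qed
next
  assume "length_at_most R (\<Union> K) (carrier R) b"
  then obtain r where r: "ideal_rank R (\<Union> K) (carrier R) b r"
    unfolding length_at_most_def by blast
  show "length_at_most (R Quot P) K (carrier (R Quot P)) b"
  proof (rule length_at_mostI[of "R Quot P" _ _ "\<lambda>U. r (\<Union> U)"])
    fix U V assume U: "ideal U (R Quot P)" and V: "ideal V (R Quot P)" and KU: "K \<subseteq> U" and UV: "U \<subset> V"
    have "\<Union> U \<noteq> \<Union> V"
      using quot_image_Union(1)[OF P U] quot_image_Union(1)[OF P V] UV by (metis psubset_eq)
    then have "\<Union> U \<subset> \<Union> V"
      using Union_mono[OF psubset_imp_subset[OF UV]] by (rule psubsetI[rotated])
    then show "r (\<Union> U) < r (\<Union> V)"
      using quot_image_Union(2)[OF P U] quot_image_Union(2)[OF P V] Union_mono[OF KU]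
      by (intro ideal_rank_less[OF r]) (auto dest: ideal_subset_carrier)
  next
    fix U assume U: "ideal U (R Quot P)" and KU: "K \<subseteq> U"
    show "r (\<Union> U) \<le> b"
      using quot_image_Union(2)[OF P U] Union_mono[OF KU]
      by (intro ideal_rank_le[OF r]) (auto dest: ideal_subset_carrier)
  qed
qed

lemma length_quot_quot:
  assumes P: "ideal P R" and K: "ideal K (R Quot P)"
  shows "length_quot (R Quot P) K = length_quot R (\<Union> K)"
proof -
  have iff: "length_quot (R Quot P) K \<le> enat b \<longleftrightarrow> length_quot R (\<Union> K) \<le> enat b" for b
    using length_quot_le_iff[OF K] length_quot_le_iff[OF quot_image_Union(2)[OF P K]]
      length_at_most_quot_iff[OF P K] by simp
  show ?thesis
  proof (rule antisym)
    show "length_quot (R Quot P) K \<le> length_quot R (\<Union> K)"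
      using iff by (cases "length_quot R (\<Union> K)") auto
    show "length_quot R (\<Union> K) \<le> length_quot (R Quot P) K"
      using iff by (cases "length_quot (R Quot P) K") auto
  qed
qed

text \<open>Minimality is used on both sides: the preimage of an ideal containing the classes of
  \<open>S\<close> is an ideal of \<open>R\<close> containing both \<open>S\<close> and
  \<open>P\<close>.\<close>

lemma genideal_quot_image:
  assumes P: "ideal P R" and S: "S \<subseteq> carrier R"
  shows "Idl\<^bsub>R Quot P\<^esub> ((+>) P ` S) = (+>) P ` (Idl (S \<union> P))"
proof
  interpret Q: ring "R Quot P" by (rule ideal.quotient_is_ring[OF P])
  have SP: "S \<union> P \<subseteq> carrier R" using S ideal_subset_carrier[OF P] by auto
  have SQ: "(+>) P ` S \<subseteq> carrier (R Quot P)" unfolding quot_carrier using S by blast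
  note I = genideal_ideal[OF SP] genideal_self[OF SP]
  show "Idl\<^bsub>R Quot P\<^esub> ((+>) P ` S) \<subseteq> (+>) P ` (Idl (S \<union> P))"
    using I by (intro Q.genideal_minimal ring_ideal_imp_quot_ideal P) auto
  define K where "K = Idl\<^bsub>R Quot P\<^esub> ((+>) P ` S)"
  have K: "ideal K (R Quot P)" "(+>) P ` S \<subseteq> K"
    unfolding K_def using Q.genideal_ideal[OF SQ] Q.genideal_self[OF SQ] by auto
  have "S \<subseteq> \<Union> ((+>) P ` S)"
    using S ideal_incl_iff[OF P] additive_subgroup.zero_closed[OF ideal.axioms(1)[OF P]]
    by (force simp: a_r_coset_def')
  then have "S \<union> P \<subseteq> \<Union> K" using K(2) quot_image_Union(3)[OF P K(1)] by blast
  then have "Idl (S \<union> P) \<subseteq> \<Union> K" by (rule genideal_minimal[OF quot_image_Union(2)[OF P K(1)]])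
  then have "(+>) P ` (Idl (S \<union> P)) \<subseteq> (+>) P ` (\<Union> K)" by (rule image_mono)
  also have "\<dots> = K" by (rule quot_image_Union(1)[OF P K(1)])
  finally show "(+>) P ` (Idl (S \<union> P)) \<subseteq> Idl\<^bsub>R Quot P\<^esub> ((+>) P ` S)"
    unfolding K_def .
qed

end

section \<open>Noetherian local rings\<close>

locale noetherian_local_cring = noetherian_cring +
  assumes unique_maximal: "\<exists>!n. maximalideal n R"
begin

lemma maximalideal_max_ideal: "maximalideal (max_ideal R) R"
  unfolding max_ideal_def by (rule theI'[OF unique_maximal])

lemma max_ideal_ideal: "ideal (max_ideal R) R"
  using maximalideal_max_ideal by (rule maximalideal.axioms(1))

lemma max_ideal_subset_carrier: "max_ideal R \<subseteq> carrier R"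
  by (rule ideal_subset_carrier[OF max_ideal_ideal])

text \<open>A maximal member among the proper ideals above \<open>I\<close> is a maximal ideal,
  hence the unique one.\<close>

lemma proper_ideal_subset_max_ideal:
  assumes "ideal I R" "I \<noteq> carrier R"
  shows "I \<subseteq> max_ideal R"
proof -
  define S where "S = {J. ideal J R \<and> I \<subseteq> J \<and> J \<noteq> carrier R}"
  have "I \<in> S" unfolding S_def using assms by simp
  then have "\<exists>N\<in>S. \<forall>J\<in>S. N \<subseteq> J \<longrightarrow> J = N"
    by (intro maximal_ideal_exists) (auto simp: S_def)
  then obtain N where N: "N \<in> S" "\<And>J. J \<in> S \<Longrightarrow> N \<subseteq> J \<Longrightarrow> J = N" by metis
  have "maximalideal N R"
  proof (rule maximalidealI)
    show "ideal N R" "carrier R \<noteq> N" using N(1) unfolding S_def by auto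
    fix J assume J: "ideal J R" "N \<subseteq> J"
    then show "J = N \<or> J = carrier R"
      using N(2)[of J] N(1) unfolding S_def by auto
  qed
  then have "N = max_ideal R" using unique_maximal maximalideal_max_ideal by blast
  then show ?thesis using N(1) unfolding S_def by blast
qed

lemma one_notin_max_ideal: "\<one> \<notin> max_ideal R"
  using maximalideal.I_notcarr[OF maximalideal_max_ideal] ideal.one_imp_carrier[OF max_ideal_ideal] by metis

lemma zero_neq_carrier: "{\<zero>} \<noteq> carrier R"
proof
  assume "{\<zero>} = carrier R"
  then have "\<one> \<in> max_ideal R"
    using additive_subgroup.zero_closed[OF ideal.axioms(1)[OF max_ideal_ideal]] one_closed
    by (metis singletonD)
  with one_notin_max_ideal show False ..
qed

lemma minimal_primes_nonempty: "minimal_primes R \<noteq> {}"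
proof
  assume "minimal_primes R = {}"
  then have "carrier R \<subseteq> {\<zero>}" using zero_eq_minimal_prime_product by auto
  then show False using zero_neq_carrier by blast
qed

text \<open>The residue field is simple: the only ideals above \<open>max_ideal R\<close> are itself
  and \<open>R\<close>, so a 0/1-valued rank suffices.\<close>

lemma length_at_most_max_ideal: "length_at_most R (max_ideal R) (carrier R) 1"
proof (rule length_at_mostI[of R _ _ "\<lambda>U. if U = carrier R then 1 else 0"])
  fix U V assume U: "ideal U R" and V: "ideal V R" "max_ideal R \<subseteq> U" "U \<subset> V" "V \<subseteq> carrier R"
  then have "V = carrier R"
    using proper_ideal_subset_max_ideal[OF V(1)] by blast
  then show "(if U = carrier R then 1 else 0) < (if V = carrier R then 1 else (0 :: nat))"
    using V(3) by auto
qed auto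

text \<open>Nakayama's lemma for one generator:
  \<open>x = a \<oplus> s \<otimes> (z \<otimes> x)\<close> gives
  \<open>(\<one> \<ominus> s \<otimes> z) \<otimes> x = a\<close>, and the coefficient is a unit
  because \<open>z\<close> lies in the maximal ideal.\<close>

lemma cyclic_nakayama:
  assumes A: "ideal A R" and x: "x \<in> carrier R" and z: "z \<in> max_ideal R"
    and mem: "x \<in> Idl (insert (z \<otimes> x) A)"
  shows "x \<in> A"
proof -
  have zR: "z \<in> carrier R" using z max_ideal_subset_carrier by blast
  obtain a s where as: "a \<in> A" "s \<in> carrier R" "x = a \<oplus> s \<otimes> (z \<otimes> x)"
    using genideal_insertE[OF A _ mem] x zR by blast
  define u where "u = \<one> \<ominus> s \<otimes> z"
  have u: "u \<in> carrier R" unfolding u_def using as zR by simp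
  have aR: "a \<in> carrier R" using as ideal.Icarr[OF A] by blast
  have "u \<otimes> x = x \<ominus> s \<otimes> (z \<otimes> x)" unfolding u_def using as(2) zR x by algebra
  also have "\<dots> = (a \<oplus> s \<otimes> (z \<otimes> x)) \<ominus> s \<otimes> (z \<otimes> x)" using as(3) by simp
  also have "\<dots> = a" using aR as(2) zR x by algebra
  finally have ux: "u \<otimes> x \<in> A" using as(1) by simp
  have "PIdl u = carrier R"
  proof (rule ccontr)
    assume "PIdl u \<noteq> carrier R"
    then have "u \<in> max_ideal R"
      using proper_ideal_subset_max_ideal[OF cgenideal_ideal[OF u]] cgenideal_self[OF u] by blast
    moreover have "s \<otimes> z \<in> max_ideal R" using ideal.I_l_closed[OF max_ideal_ideal z as(2)] .
    moreover have "\<one> = u \<oplus> s \<otimes> z" unfolding u_def using as(2) zR by algebra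
    ultimately show False using one_notin_max_ideal ideal_add[OF max_ideal_ideal] by metis
  qed
  then obtain v where v: "v \<in> carrier R" "\<one> = v \<otimes> u" unfolding cgenideal_def using one_closed by blast
  have "x = v \<otimes> (u \<otimes> x)" using v x u by (metis l_one m_assoc)
  then show ?thesis using ideal.I_l_closed[OF A ux v(1)] by simp
qed

text \<open>Along a composition series of \<open>R / A\<close>, each simple factor \<open>Rx\<close> contributes at most
  the length of \<open>R / (g(\<mm>)R + a)\<close>, because \<open>g(\<mm>)\<close> maps \<open>g(x)\<close> into the previous step.\<close>
lemma length_at_most_image:
  assumes g: "g \<in> ring_hom R R" and A: "ideal A R" and a: "ideal a R"
    and lenA: "length_at_most R A (carrier R) b"
    and len: "length_at_most R (Idl (g ` max_ideal R \<union> a)) (carrier R) c"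
  shows "length_at_most R (Idl (g ` A \<union> a)) (carrier R) (b * c)"
proof -
  have gR: "g x \<in> carrier R" if "x \<in> carrier R" for x by (rule ring_hom_closed[OF g that])
  have carr: "g ` U \<union> a \<subseteq> carrier R" if "U \<subseteq> carrier R" for U
    using that gR ideal_subset_carrier[OF a] by auto
  obtain r where r: "ideal_rank R A (carrier R) b r" using lenA unfolding length_at_most_def by blast
  \<comment> \<open>Generalised from \<open>A\<close> to every ideal above it, the bound is proved
    from the top downwards by induction on the remaining rank \<open>b - r U\<close>.\<close>
  have "length_at_most R (Idl (g ` U \<union> a)) (carrier R) ((b - r U) * c)"
    if "ideal U R" "A \<subseteq> U" for U
    using that
  proof (induction "b - r U" arbitrary: U rule: less_induct)
    case less
    note U = less.prems(1)
    have UR: "U \<subseteq> carrier R" by (rule ideal_subset_carrier[OF U])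
    define I where "I = Idl (g ` U \<union> a)"
    have I: "ideal I R" "g ` U \<union> a \<subseteq> I"
      unfolding I_def by (rule genideal_ideal[OF carr[OF UR]], rule genideal_self[OF carr[OF UR]])
    show ?case
    proof (cases "U = carrier R")
      case True
      have "g \<one> \<in> I" using I(2) True by blast
      then have "I = carrier R" using ring_hom_one[OF g] ideal.one_imp_carrier[OF I(1)] by simp
      then show ?thesis
        unfolding I_def[symmetric] by (auto intro: length_at_most_mono[OF length_at_most_refl])
    next
      case False
      \<comment> \<open>An ideal of least rank strictly above \<open>U\<close> covers
        \<open>U\<close>, so \<open>V / U\<close> is simple. This produces the composition series
        one step at a time.\<close>
      define S where "S = {V. ideal V R \<and> U \<subset> V}"
      have "carrier R \<in> S" unfolding S_def using oneideal UR False by blast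
      then obtain V where V: "V \<in> S" "\<And>W. W \<in> S \<Longrightarrow> r V \<le> r W"
        using ex_has_least_nat[of "\<lambda>V. V \<in> S" "carrier R" r] by blast
      have VI: "ideal V R" "U \<subset> V" using V(1) unfolding S_def by auto
      have VR: "V \<subseteq> carrier R" by (rule ideal_subset_carrier[OF VI(1)])
      have min: "W = V" if W: "ideal W R" "U \<subset> W" "W \<subseteq> V" for W
      proof (rule ccontr)
        assume "W \<noteq> V"
        then have "r W < r V"
          using W less.prems(2) VR by (intro ideal_rank_less[OF r W(1) VI(1)]) auto
        then show False using V(2)[of W] W unfolding S_def by auto
      qed
      obtain x where x: "x \<in> V" "x \<notin> U" using VI(2) by blast
      have xR: "x \<in> carrier R" using x VR by blast
      have cover: "Idl (insert y U) = V" if y: "y \<in> V" "y \<notin> U" for y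
      proof (rule min)
        have c: "insert y U \<subseteq> carrier R" using y VR UR by blast
        show "ideal (Idl (insert y U)) R" by (rule genideal_ideal[OF c])
        show "U \<subset> Idl (insert y U)" using genideal_self[OF c] y by blast
        show "Idl (insert y U) \<subseteq> V" using y VI by (intro genideal_minimal) auto
      qed
      \<comment> \<open>Otherwise \<open>z \<otimes> x\<close> would already generate
        \<open>V\<close> over \<open>U\<close>, and Nakayama would put \<open>x\<close> into
        \<open>U\<close>.\<close>
      have mx: "z \<otimes> x \<in> U" if z: "z \<in> max_ideal R" for z
      proof (rule ccontr)
        assume zx: "z \<otimes> x \<notin> U"
        have "z \<otimes> x \<in> V"
          using ideal.I_l_closed[OF VI(1) x(1)] z max_ideal_subset_carrier by blast
        then have "x \<in> Idl (insert (z \<otimes> x) U)" using cover[OF _ zx] x(1) by simp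
        then show False using cyclic_nakayama[OF U xR z] x(2) by blast
      qed
      define I' where "I' = Idl (insert (g x) I)"
      have gxI: "insert (g x) I \<subseteq> carrier R" using gR[OF xR] ideal_subset_carrier[OF I(1)] by blast
      have I': "ideal I' R" "insert (g x) I \<subseteq> I'"
        unfolding I'_def using genideal_ideal[OF gxI] genideal_self[OF gxI] by auto
      have "length_at_most R I I' c"
        unfolding I'_def
      proof (rule length_at_most_insert[OF I(1) gR[OF xR] _ len])
        fix w assume w: "w \<in> Idl (g ` max_ideal R \<union> a)"
        have "Idl (g ` max_ideal R \<union> a) \<subseteq> {w \<in> carrier R. w \<otimes> g x \<in> I}"
        proof (rule genideal_minimal[OF colon_ideal[OF I(1) gR[OF xR]]])
          have "g z \<otimes> g x \<in> I" if z: "z \<in> max_ideal R" for z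
          proof -
            have "g z \<otimes> g x = g (z \<otimes> x)"
              using ring_hom_mult[OF g] z max_ideal_subset_carrier xR by auto
            then show ?thesis using mx[OF z] I(2) by auto
          qed
          moreover have "w \<otimes> g x \<in> I" if "w \<in> a" for w
            using ideal.I_r_closed[OF I(1) _ gR[OF xR]] that I(2) by blast
          ultimately show "g ` max_ideal R \<union> a \<subseteq> {w \<in> carrier R. w \<otimes> g x \<in> I}"
            using carr[OF max_ideal_subset_carrier] by blast
        qed
        then show "w \<in> carrier R \<and> w \<otimes> g x \<in> I" using w by blast
      qed
      moreover have rUV: "r U < r V" "r V \<le> b"
        using less.prems VI VR by (auto intro!: ideal_rank_less[OF r] ideal_rank_le[OF r])
      have "length_at_most R I' (carrier R) ((b - r V) * c)"
      proof (rule length_at_most_mono)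
        show "length_at_most R (Idl (g ` V \<union> a)) (carrier R) ((b - r V) * c)"
          using less.hyps[of V] rUV VI less.prems(2) by auto
        have "g ` (Idl (insert x U)) \<subseteq> I'"
          using I(2) I'(2) xR UR by (intro ring_hom_image_subset[OF g I'(1)]) auto
        then have "g ` V \<subseteq> I'" using cover[OF x] by simp
        then show "Idl (g ` V \<union> a) \<subseteq> I'"
          using I(2) I'(2) by (intro genideal_minimal[OF I'(1)]) auto
      qed auto
      ultimately have "length_at_most R I (carrier R) (c + (b - r V) * c)"
        using I' by (intro length_at_most_trans[OF I'(1) _ _ oneideal]) (auto dest: ideal_subset_carrier)
      \<comment> \<open>The bound \<open>r V \<le> b\<close> ensures that the truncated subtraction
        really drops by at least one from \<open>U\<close> to \<open>V\<close>.\<close>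
      moreover have "c + (b - r V) * c \<le> (b - r U) * c"
      proof -
        have "c + (b - r V) * c = Suc (b - r V) * c" by simp
        also have "\<dots> \<le> (b - r U) * c" using rUV by (intro mult_le_mono1) simp
        finally show ?thesis .
      qed
      ultimately show ?thesis unfolding I_def by (auto intro: length_at_most_mono)
    qed
  qed
  from this[OF A order_refl] show ?thesis by (rule length_at_most_mono) auto
qed

text \<open>Every proper ideal of the quotient has a proper preimage, which lies in
  \<open>max_ideal R\<close>. Thus the image of \<open>max_ideal R\<close> contains all proper
  ideals and is the only maximal one.\<close>

lemma max_ideal_quot:
  assumes P: "ideal P R" "P \<noteq> carrier R"
  shows "max_ideal (R Quot P) = (+>) P ` max_ideal R"
proof -
  interpret Q: ring "R Quot P" by (rule ideal.quotient_is_ring[OF P(1)])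
  let ?N = "(+>) P ` max_ideal R"
  have N: "ideal ?N (R Quot P)" by (rule ring_ideal_imp_quot_ideal[OF P(1) max_ideal_ideal])
  have UN: "\<Union> ?N = max_ideal R"
    by (rule Union_quot_image[OF P(1) max_ideal_ideal proper_ideal_subset_max_ideal[OF P]])
  have neq: "carrier (R Quot P) \<noteq> ?N"
    using UN Union_quot_carrier[OF P(1)] maximalideal.I_notcarr[OF maximalideal_max_ideal] by metis
  have proper: "K \<subseteq> ?N" if K: "ideal K (R Quot P)" "K \<noteq> carrier (R Quot P)" for K
  proof -
    note U = quot_image_Union[OF P(1) K(1)]
    have "\<Union> K \<noteq> carrier R" using U(1) K(2) unfolding quot_carrier by metis
    then have "\<Union> K \<subseteq> max_ideal R" by (rule proper_ideal_subset_max_ideal[OF U(2)])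
    then have "(+>) P ` (\<Union> K) \<subseteq> ?N" by (rule image_mono)
    then show ?thesis unfolding U(1) .
  qed
  have max: "maximalideal ?N (R Quot P)"
    using proper by (intro maximalidealI N neq) blast
  show ?thesis
    unfolding max_ideal_def[of "R Quot P"]
  proof (rule the_equality, rule max)
    fix n assume n: "maximalideal n (R Quot P)"
    note nI = maximalideal.axioms(1)[OF n]
    have "n \<subseteq> ?N" by (rule proper[OF nI]) (use maximalideal.I_notcarr[OF n] in auto)
    then show "n = ?N"
      using maximalideal.I_maximal[OF n N] neq additive_subgroup.a_subset[OF ideal.axioms(1)[OF N]] by auto
  qed
qed

end

section \<open>Entropy of self-maps of finite length\<close>

locale local_self_map = noetherian_local_cring +
  fixes \<phi> :: "'a \<Rightarrow> 'a"
  assumes finite_length: "self_map_finite_length R \<phi>"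
begin

text \<open>For \<open>a = {\<zero>}\<close> this is the ideal defining the entropy of
  \<open>R\<close>; for \<open>a = P\<close> it is the preimage in \<open>R\<close> of the
  corresponding ideal of \<open>R / P\<close>. All entropies are thus computed inside
  \<open>R\<close>.\<close>

definition expansion :: "nat \<Rightarrow> 'a set \<Rightarrow> 'a set" where
  "expansion n a = Idl ((\<phi> ^^ n) ` max_ideal R \<union> a)"

definition quot_length :: "'a set \<Rightarrow> nat \<Rightarrow> nat" where
  "quot_length a n = the_enat (length_quot R (expansion n a))"

lemma hom: "\<phi> \<in> ring_hom R R"
  using finite_length unfolding self_map_finite_length_def by blast

lemma funpow_hom: "\<phi> ^^ n \<in> ring_hom R R"
proof (induction n)
  case 0
  show ?case by (simp add: ring_hom_def)
next
  case (Suc n)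
  show ?case unfolding funpow.simps(2) by (rule ring_hom_trans[OF Suc hom])
qed

lemma funpow_closed: "x \<in> carrier R \<Longrightarrow> (\<phi> ^^ n) x \<in> carrier R"
  by (rule ring_hom_closed[OF funpow_hom])

lemma funpow_max_ideal: "(\<phi> ^^ n) ` max_ideal R \<subseteq> max_ideal R"
proof (induction n)
  case (Suc n)
  have "\<phi> ` max_ideal R \<subseteq> max_ideal R"
    using finite_length unfolding self_map_finite_length_def by blast
  with Suc show ?case by auto
qed simp

lemma funpow_stable: "\<phi> ` a \<subseteq> a \<Longrightarrow> (\<phi> ^^ n) ` a \<subseteq> a"
  by (induction n) auto

context
  fixes a :: "'a set"
  assumes a: "ideal a R"
begin

lemma expansion_carrier: "(\<phi> ^^ n) ` max_ideal R \<union> a \<subseteq> carrier R"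
  using funpow_max_ideal max_ideal_subset_carrier ideal_subset_carrier[OF a] by blast

lemma expansion_ideal: "ideal (expansion n a) R"
  unfolding expansion_def by (rule genideal_ideal[OF expansion_carrier])

lemma expansion_superset: "(\<phi> ^^ n) ` max_ideal R \<union> a \<subseteq> expansion n a"
  unfolding expansion_def by (rule genideal_self[OF expansion_carrier])

lemma expansion_subset_max_ideal: "a \<noteq> carrier R \<Longrightarrow> expansion n a \<subseteq> max_ideal R"
  unfolding expansion_def
  using funpow_max_ideal proper_ideal_subset_max_ideal[OF a]
  by (intro genideal_minimal[OF max_ideal_ideal]) simp

lemma expansion_mono:
  assumes "b \<subseteq> a"
  shows "expansion n b \<subseteq> expansion n a"
  unfolding expansion_def using assms by (intro subset_Idl_subset[OF expansion_carrier]) auto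

text \<open>\<open>length_at_most_image\<close> is applied to the \<open>n\<close>-th iterate and
  the ideal \<open>expansion m a\<close>. Stability of \<open>a\<close> keeps the image of that
  ideal inside \<open>expansion (m + n) a\<close>.\<close>

lemma length_at_most_expansion_add:
  assumes stable: "\<phi> ` a \<subseteq> a"
    and "length_at_most R (expansion m a) (carrier R) b" "length_at_most R (expansion n a) (carrier R) c"
  shows "length_at_most R (expansion (m + n) a) (carrier R) (b * c)"
proof (rule length_at_most_mono)
  show "length_at_most R (Idl ((\<phi> ^^ n) ` expansion m a \<union> a)) (carrier R) (b * c)"
    using length_at_most_image[OF funpow_hom expansion_ideal a assms(2)] assms(3)
    unfolding expansion_def[of n] .
  have "(\<phi> ^^ n) ` (\<phi> ^^ m) ` max_ideal R \<subseteq> expansion (m + n) a"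
    using expansion_superset[of "m + n"] by (simp add: image_comp funpow_add[symmetric] add.commute)
  moreover have "(\<phi> ^^ n) ` a \<subseteq> expansion (m + n) a"
    using funpow_stable[OF stable, of n] expansion_superset[of "m + n"] by blast
  ultimately have "(\<phi> ^^ n) ` expansion m a \<subseteq> expansion (m + n) a"
    unfolding expansion_def[of m]
    by (intro ring_hom_image_subset[OF funpow_hom expansion_ideal expansion_carrier]) auto
  then show "Idl ((\<phi> ^^ n) ` expansion m a \<union> a) \<subseteq> expansion (m + n) a"
    using expansion_superset[of "m + n"] by (intro genideal_minimal[OF expansion_ideal]) auto
qed auto

end

lemma expansion_zero: "expansion n {\<zero>} = Idl ((\<phi> ^^ n) ` max_ideal R)"
proof
  have carr: "(\<phi> ^^ n) ` max_ideal R \<subseteq> carrier R"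
    using expansion_carrier[OF zeroideal] by blast
  have I: "ideal (Idl ((\<phi> ^^ n) ` max_ideal R)) R" by (rule genideal_ideal[OF carr])
  then show "expansion n {\<zero>} \<subseteq> Idl ((\<phi> ^^ n) ` max_ideal R)"
    unfolding expansion_def using genideal_self[OF carr] additive_subgroup.zero_closed[OF ideal.axioms(1)[OF I]]
    by (intro genideal_minimal) auto
  show "Idl ((\<phi> ^^ n) ` max_ideal R) \<subseteq> expansion n {\<zero>}"
    unfolding expansion_def by (intro subset_Idl_subset[OF expansion_carrier[OF zeroideal]]) auto
qed

text \<open>The primary condition enters here: a prime over the expansion contains its radical, the
  maximal ideal. A product of such primes lies in the expansion, so the quotient has a finite
  filtration by finitely generated modules over the residue field.\<close>

lemma length_at_most_expansion_1: "\<exists>b. length_at_most R (expansion 1 {\<zero>}) (carrier R) b"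
proof -
  have I: "ideal (expansion 1 {\<zero>}) R" by (rule expansion_ideal[OF zeroideal])
  have rad: "radical R (expansion 1 {\<zero>}) = max_ideal R"
    using finite_length unfolding self_map_finite_length_def is_primary_for_def expansion_zero by simp
  obtain Ps where Ps: "\<And>P. P \<in> set Ps \<Longrightarrow> primeideal P R \<and> expansion 1 {\<zero>} \<subseteq> P"
    "ideal_prod_list Ps \<subseteq> expansion 1 {\<zero>}"
    using ideal_contains_prime_product[OF I] by blast
  have PI: "ideal P R" if "P \<in> set Ps" for P using Ps(1)[OF that] primeideal.axioms(1) by blast
  obtain C where C: "\<And>I b. ideal I R \<Longrightarrow> ideal_prod_list Ps \<subseteq> I \<Longrightarrow>
      (\<And>P. P \<in> set Ps \<Longrightarrow> length_at_most R (Idl (I \<union> P)) (carrier R) b) \<Longrightarrow>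
      length_at_most R I (carrier R) (C * b)"
    using length_at_most_product[of Ps] PI by metis
  have "length_at_most R (expansion 1 {\<zero>}) (carrier R) (C * 1)"
  proof (rule C[OF I Ps(2)])
    fix P assume P: "P \<in> set Ps"
    have "max_ideal R \<subseteq> P"
    proof
      fix x assume "x \<in> max_ideal R"
      then obtain k :: nat where "x \<in> carrier R" "x [^] k \<in> expansion 1 {\<zero>}"
        unfolding rad[symmetric] radical_def by blast
      then show "x \<in> P" using primeideal_pow[of P x k] Ps(1)[OF P] by blast
    qed
    also have "P \<subseteq> Idl (expansion 1 {\<zero>} \<union> P)"
      using genideal_self[of "expansion 1 {\<zero>} \<union> P"] ideal_subset_carrier[OF I]
        ideal_subset_carrier[OF PI[OF P]] by simp
    finally show "length_at_most R (Idl (expansion 1 {\<zero>} \<union> P)) (carrier R) 1"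
      by (rule length_at_most_mono[OF length_at_most_max_ideal]) auto
  qed
  then show ?thesis ..
qed

lemma zero_stable: "\<phi> ` {\<zero>} \<subseteq> {\<zero>}"
proof -
  interpret g: ring_hom_ring R R \<phi> by (rule ring_hom_ringI2[OF ring_axioms ring_axioms hom])
  show ?thesis by simp
qed

text \<open>Submultiplicativity propagates finiteness from exponent 1 to all exponents for the zero
  ideal; enlarging the ideal to include \<open>a\<close> preserves the bound.\<close>

lemma expansion_finite_length:
  assumes "ideal a R"
  shows "\<exists>b. length_at_most R (expansion n a) (carrier R) b"
proof -
  have "\<exists>b. length_at_most R (expansion n {\<zero>}) (carrier R) b"
  proof (induction n)
    case 0
    have "max_ideal R \<subseteq> expansion 0 {\<zero>}" using expansion_superset[OF zeroideal, of 0] by simp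
    then show ?case
      using length_at_most_mono[OF length_at_most_max_ideal _ order_refl order_refl] by blast
  next
    case (Suc n)
    then show ?case
      using length_at_most_expansion_1 length_at_most_expansion_add[OF zeroideal zero_stable, of n _ 1]
      by (metis Suc_eq_plus1)
  qed
  moreover have "expansion n {\<zero>} \<subseteq> expansion n a"
    using additive_subgroup.zero_closed[OF ideal.axioms(1)[OF assms]] by (intro expansion_mono[OF assms]) simp
  ultimately show ?thesis using length_at_most_mono[OF _ _ order_refl order_refl] by blast
qed

text \<open>By finiteness \<open>quot_length a n\<close> is the least bound, so inequalities between
  lengths can be proved by exhibiting bounds.\<close>

lemma length_at_most_expansion_iff:
  assumes "ideal a R"
  shows "length_at_most R (expansion n a) (carrier R) b \<longleftrightarrow> quot_length a n \<le> b"
proof -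
  obtain b0 where "length_at_most R (expansion n a) (carrier R) b0"
    using expansion_finite_length[OF assms] by blast
  from length_quot_eq_enat[OF expansion_ideal[OF assms] this]
  obtain l where "length_quot R (expansion n a) = enat l"
    "\<forall>c. length_at_most R (expansion n a) (carrier R) c \<longleftrightarrow> l \<le> c" by (elim exE conjE)
  then show ?thesis unfolding quot_length_def by simp
qed

lemma length_at_most_quot_length:
  "ideal a R \<Longrightarrow> length_at_most R (expansion n a) (carrier R) (quot_length a n)"
  by (simp add: length_at_most_expansion_iff)

lemma quot_length_add:
  "ideal a R \<Longrightarrow> \<phi> ` a \<subseteq> a \<Longrightarrow> quot_length a (m + n) \<le> quot_length a m * quot_length a n"
  by (simp add: length_at_most_expansion_add length_at_most_quot_length flip: length_at_most_expansion_iff)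

lemma quot_length_antimono:
  assumes "ideal a R" "ideal b R" "a \<subseteq> b"
  shows "quot_length b n \<le> quot_length a n"
  using expansion_mono[OF assms(2,3)]
  unfolding length_at_most_expansion_iff[OF assms(2), symmetric]
  by (intro length_at_most_mono[OF length_at_most_quot_length[OF assms(1)]]) auto

text \<open>The expansion stays inside the maximal ideal, so it and \<open>R\<close> form a chain of
  length one. This keeps the logarithms nonnegative.\<close>

lemma quot_length_pos:
  assumes a: "ideal a R" "a \<noteq> carrier R"
  shows "quot_length a n \<ge> 1"
proof -
  obtain r where r: "ideal_rank R (expansion n a) (carrier R) (quot_length a n) r"
    using length_at_most_quot_length[OF a(1)] unfolding length_at_most_def by blast
  have sub: "expansion n a \<subseteq> max_ideal R" by (rule expansion_subset_max_ideal[OF a])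
  have "expansion n a \<subset> carrier R"
    using sub max_ideal_subset_carrier one_notin_max_ideal by blast
  then have "r (expansion n a) < r (carrier R)"
    using ideal_rank_less[OF r expansion_ideal[OF a(1)] oneideal] by blast
  also have "r (carrier R) \<le> quot_length a n"
    using ideal_rank_le[OF r oneideal] \<open>expansion n a \<subset> carrier R\<close> by blast
  finally show ?thesis by simp
qed

text \<open>Logarithms turn submultiplicativity into subadditivity, and Fekete applies. Since
  \<open>lim\<close> is a definite description, convergence is what gives the entropy its
  meaning.\<close>

lemma quot_length_tendsto:
  assumes a: "ideal a R" "a \<noteq> carrier R" "\<phi> ` a \<subseteq> a"
  shows "(\<lambda>n. ln (real (quot_length a n)) / real n) \<longlonglongrightarrow>
    lim (\<lambda>n. ln (real (quot_length a n)) / real n)"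
proof -
  have pos: "real (quot_length a n) \<ge> 1" for n
    using quot_length_pos[OF a(1,2), of n] by simp
  have "convergent (\<lambda>n. ln (real (quot_length a n)) / real n)"
  proof (rule fekete_subadditive_convergent)
    fix m n
    have "real (quot_length a (m + n)) \<le> real (quot_length a m) * real (quot_length a n)"
      using quot_length_add[OF a(1,3), of m n] by (metis of_nat_le_iff of_nat_mult)
    then have "ln (real (quot_length a (m + n))) \<le> ln (real (quot_length a m) * real (quot_length a n))"
      using pos[of "m + n"] by (intro ln_mono) auto
    also have "\<dots> = ln (real (quot_length a m)) + ln (real (quot_length a n))"
      using pos[of m] pos[of n] by (intro ln_mult_pos) auto
    finally show "ln (real (quot_length a (m + n))) \<le> ln (real (quot_length a m)) + ln (real (quot_length a n))" .
  qed (use pos in simp)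
  then show ?thesis by (simp add: convergent_LIMSEQ_iff)
qed

section \<open>Entropies of the ring and its quotients as growth rates of
  \<open>quot_length\<close>\<close>

lemma h_alg_self: "h_alg \<phi> R = lim (\<lambda>n. ln (real (quot_length {\<zero>} n)) / real n)"
  unfolding h_alg_def lambda_len_def quot_length_def expansion_zero ..

text \<open>The representative picked by \<open>SOME\<close> differs from \<open>x\<close> by an
  element of \<open>P\<close>, and \<phi> sends this difference back into \<open>P\<close>.\<close>

lemma induced_map_coset:
  assumes P: "ideal P R" and stable: "\<phi> ` P \<subseteq> P" and x: "x \<in> carrier R"
  shows "induced_map R P \<phi> (P +> x) = P +> \<phi> x"
proof -
  interpret P: ideal P R by fact
  interpret g: ring_hom_ring R R \<phi> by (rule ring_hom_ringI2[OF ring_axioms ring_axioms hom])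
  define y where "y = (SOME y. y \<in> P +> x)"
  have "x \<in> P +> x" using P.a_rcos_self[OF x] .
  then have "y \<in> P +> x" unfolding y_def by (rule someI)
  then obtain p where p: "p \<in> P" "y = p \<oplus> x" unfolding a_r_coset_def' by blast
  have pR: "p \<in> carrier R" using p P.Icarr by blast
  have "\<phi> y \<ominus> \<phi> x = \<phi> p \<oplus> \<phi> x \<ominus> \<phi> x" using p pR x by simp
  also have "\<dots> = \<phi> p" using g.hom_closed[OF pR] g.hom_closed[OF x] by algebra
  finally have "\<phi> y \<ominus> \<phi> x \<in> P" using stable p(1) by auto
  then have "P +> \<phi> y = P +> \<phi> x"
    using quotient_eq_iff_same_a_r_cos[OF P, of "\<phi> y" "\<phi> x"] p pR x by simp
  then show ?thesis unfolding induced_map_def y_def .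
qed

text \<open>Iterates of the induced map act on cosets through iterates of \<phi>, so the two length
  sequences agree term by term, not only asymptotically.\<close>

lemma h_alg_quot:
  assumes P: "ideal P R" "P \<noteq> carrier R" and stable: "\<phi> ` P \<subseteq> P"
  shows "h_alg (induced_map R P \<phi>) (R Quot P) = lim (\<lambda>n. ln (real (quot_length P n)) / real n)"
proof -
  have "lambda_len (R Quot P) (induced_map R P \<phi>) n = length_quot R (expansion n P)" for n
  proof -
    have iter: "(induced_map R P \<phi> ^^ n) (P +> x) = P +> (\<phi> ^^ n) x" if "x \<in> carrier R" for x
      by (induction n) (simp_all add: induced_map_coset[OF P(1) stable] funpow_closed that)
    have "(induced_map R P \<phi> ^^ n) ` (+>) P ` max_ideal R = (+>) P ` (\<phi> ^^ n) ` max_ideal R"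
      unfolding image_image using iter max_ideal_subset_carrier by (intro image_cong) auto
    then have "Idl\<^bsub>R Quot P\<^esub> ((induced_map R P \<phi> ^^ n) ` max_ideal (R Quot P)) = (+>) P ` expansion n P"
      unfolding max_ideal_quot[OF P] expansion_def
      using genideal_quot_image[OF P(1)] expansion_carrier[OF P(1)] by simp
    then show ?thesis
      unfolding lambda_len_def
      using length_quot_quot[OF P(1) ring_ideal_imp_quot_ideal[OF P(1) expansion_ideal[OF P(1)]]]
        Union_quot_image[OF P(1) expansion_ideal[OF P(1)]] expansion_superset[OF P(1)] by simp
  qed
  then show ?thesis unfolding h_alg_def quot_length_def by simp
qed

text \<open>A vanishing product of minimal primes is fixed once for all \<open>n\<close>, so the
  constant of \<open>length_at_most_product\<close> is uniform; only the prime may vary with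
  \<open>n\<close>.\<close>

lemma quot_length_zero_le_minimal_prime:
  "\<exists>C. \<forall>n. \<exists>P\<in>minimal_primes R. quot_length {\<zero>} n \<le> C * quot_length P n"
proof -
  have minI: "ideal P R" if "P \<in> minimal_primes R" for P
    using that primeideal.axioms(1) unfolding minimal_primes_def by blast
  obtain Ps where Ps: "set Ps \<subseteq> minimal_primes R" "ideal_prod_list Ps \<subseteq> {\<zero>}"
    using zero_eq_minimal_prime_product by blast
  obtain C where C: "\<And>I b. ideal I R \<Longrightarrow> ideal_prod_list Ps \<subseteq> I \<Longrightarrow>
      (\<And>P. P \<in> set Ps \<Longrightarrow> length_at_most R (Idl (I \<union> P)) (carrier R) b) \<Longrightarrow>
      length_at_most R I (carrier R) (C * b)"
    using length_at_most_product[of Ps] Ps(1) minI by (metis subsetD)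
  have "\<exists>P\<in>minimal_primes R. quot_length {\<zero>} n \<le> C * quot_length P n" for n
  proof -
    \<comment> \<open>A common bound for all factors of the product is required; the maximum is
      attained at some minimal prime, which becomes the witness.\<close>
    define b where "b = Max ((\<lambda>P. quot_length P n) ` minimal_primes R)"
    have "b \<in> (\<lambda>P. quot_length P n) ` minimal_primes R"
      unfolding b_def using finite_minimal_primes minimal_primes_nonempty by (intro Max_in) auto
    then obtain P0 where P0: "P0 \<in> minimal_primes R" "b = quot_length P0 n" by blast
    let ?I = "expansion n {\<zero>}"
    have I: "ideal ?I R" by (rule expansion_ideal[OF zeroideal])
    have sup: "(\<phi> ^^ n) ` max_ideal R \<union> {\<zero>} \<subseteq> ?I" by (rule expansion_superset[OF zeroideal])
    have "length_at_most R ?I (carrier R) (C * b)"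
    proof (rule C[OF I])
      show "ideal_prod_list Ps \<subseteq> ?I" using Ps(2) sup by (meson Un_subset_iff order_trans)
      fix P assume "P \<in> set Ps"
      then have P: "P \<in> minimal_primes R" using Ps(1) by blast
      have "expansion n P \<subseteq> Idl (?I \<union> P)"
        unfolding expansion_def[of n P]
        using sup ideal_subset_carrier[OF I] ideal_subset_carrier[OF minI[OF P]]
        by (intro subset_Idl_subset) auto
      moreover have "quot_length P n \<le> b"
        unfolding b_def using P finite_minimal_primes by (intro Max_ge) auto
      ultimately show "length_at_most R (Idl (?I \<union> P)) (carrier R) b"
        by (intro length_at_most_mono[OF length_at_most_quot_length[OF minI[OF P]]]) auto
    qed
    then show ?thesis unfolding length_at_most_expansion_iff[OF zeroideal] using P0 by blast
  qed
  then show ?thesis by blast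
qed

end

theorem mainTheorem11:
  fixes R :: "('a, 'b) ring_scheme" and \<phi> :: "'a \<Rightarrow> 'a"
  assumes "noetherian_local_ring R"
    and "self_map_finite_length R \<phi>"
    and "\<And>p. p \<in> minimal_primes R \<Longrightarrow> Idl\<^bsub>R\<^esub> (\<phi> ` p) \<subseteq> p"
  shows "h_alg \<phi> R = Max {h_alg (induced_map R p \<phi>) (R Quot p) | p. p \<in> minimal_primes R}"
proof -
  interpret noetherian_ring R using assms(1) unfolding noetherian_local_ring_def by blast
  interpret cring R using assms(1) unfolding noetherian_local_ring_def local_ring_def by blast
  interpret local_self_map R \<phi>
    using assms(1,2) unfolding noetherian_local_ring_def local_ring_def by unfold_locales auto
  let ?l = "\<lambda>a n. ln (real (quot_length a n)) / real n"
  have P: "ideal p R" "p \<noteq> carrier R" "\<phi> ` p \<subseteq> p" if "p \<in> minimal_primes R" for p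
  proof -
    have prime: "primeideal p R" using that unfolding minimal_primes_def by blast
    show I: "ideal p R" using prime by (rule primeideal.axioms(1))
    show "p \<noteq> carrier R" using primeideal.I_notcarr[OF prime] by blast
    have "\<phi> ` p \<subseteq> carrier R" using ideal_subset_carrier[OF I] funpow_closed[of _ 1] by auto
    then show "\<phi> ` p \<subseteq> p" using genideal_self assms(3)[OF that] by blast
  qed
  obtain C where C: "\<And>n. \<exists>p\<in>minimal_primes R. quot_length {\<zero>\<^bsub>R\<^esub>} n \<le> C * quot_length p n"
    using quot_length_zero_le_minimal_prime by blast
  have pos: "real (quot_length p n) \<ge> 1" if "p \<in> minimal_primes R" for p n
    using quot_length_pos[OF P(1,2)[OF that], of n] by simp
  have pos0: "real (quot_length {\<zero>\<^bsub>R\<^esub>} n) \<ge> 1" for n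
    using quot_length_pos[OF zeroideal zero_neq_carrier, of n] by simp
  have "lim (?l {\<zero>\<^bsub>R\<^esub>}) = Max ((\<lambda>p. lim (?l p)) ` minimal_primes R)"
  proof (rule lim_eq_Max_lim[OF finite_minimal_primes minimal_primes_nonempty])
    show "?l {\<zero>\<^bsub>R\<^esub>} \<longlonglongrightarrow> lim (?l {\<zero>\<^bsub>R\<^esub>})"
      by (rule quot_length_tendsto[OF zeroideal zero_neq_carrier zero_stable])
    show "?l p \<longlonglongrightarrow> lim (?l p)" if "p \<in> minimal_primes R" for p
      by (rule quot_length_tendsto[OF P[OF that]])
    fix n :: nat assume n: "n \<ge> 1"
    show "?l p n \<le> ?l {\<zero>\<^bsub>R\<^esub>} n" if p: "p \<in> minimal_primes R" for p
    proof -
      have "quot_length p n \<le> quot_length {\<zero>\<^bsub>R\<^esub>} n"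
        using additive_subgroup.zero_closed[OF ideal.axioms(1)[OF P(1)[OF p]]]
        by (intro quot_length_antimono zeroideal P(1)[OF p]) simp
      then show ?thesis using pos[OF p, of n] by (intro divide_right_mono ln_mono) auto
    qed
    obtain p where p: "p \<in> minimal_primes R" "quot_length {\<zero>\<^bsub>R\<^esub>} n \<le> C * quot_length p n"
      using C by blast
    have le: "real (quot_length {\<zero>\<^bsub>R\<^esub>} n) \<le> real C * real (quot_length p n)"
      using p(2) by (metis of_nat_le_iff of_nat_mult)
    \<comment> \<open>Lengths over \<open>R\<close> are at least 1, which excludes
      \<open>C = 0\<close> and makes the logarithm of the product split.\<close>
    then have "C > 0" using pos0[of n] by (cases C) auto
    then have "ln (real (quot_length {\<zero>\<^bsub>R\<^esub>} n)) \<le> ln (real C) + ln (real (quot_length p n))"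
      using ln_mono[OF le] pos0[of n] pos[OF p(1), of n] by (simp add: ln_mult_pos)
    then have "?l {\<zero>\<^bsub>R\<^esub>} n \<le> ln (real C) / real n + ?l p n"
      by (simp add: divide_right_mono flip: add_divide_distrib)
    then show "\<exists>p\<in>minimal_primes R. ?l {\<zero>\<^bsub>R\<^esub>} n \<le> ln (real C) / real n + ?l p n"
      using p(1) by blast
  qed
  also have "(\<lambda>p. lim (?l p)) ` minimal_primes R =
      (\<lambda>p. h_alg (induced_map R p \<phi>) (R Quot p)) ` minimal_primes R"
    using h_alg_quot[OF P] by (intro image_cong) auto
  finally show ?thesis unfolding h_alg_self Setcompr_eq_image .
qed

end
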